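(* Let $\mathcal A$ be a finite alphabet, $X\subset\mathcal A^{\mathbb Z}$ a bi-sided subshift, and $X_\infty\subset X$ a closed $\tau$-invariant subset. Let $\{M_i:i\in I\}$ be a net of clopen subsets of $X$ such that $X_\infty\subset M_i$ for every $i$ and $M_i\to X_\infty$ in the Fell topology of $\mathrm{Cl}(X)$. Let $h\in C_c(X\times\mathbb Z)$ be self-adjoint, i.e. $h(\tau_k(x),-k)=\overline{h(x,k)}$ for all $x\in X$, $k\in\mathbb Z$. Then $$\inf_{x\in X_\infty}\inf\mathrm{sp}(\mathsf H^{X_\infty}_x)=\sup_{i\in I}\Big[\inf_{y\in M_i}\inf\mathrm{sp}(\mathsf H^{M_i}_y)\Big],\qquad \sup_{x\in X_\infty}\sup\mathrm{sp}(\mathsf H^{X_\infty}_x)=\inf_{i\in I}\Big[\sup_{y\in M_i}\sup\mathrm{sp}(\mathsf H^{M_i}_y)\Big].$$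
   Context: $\mathcal A^{\mathbb Z}$ carries the product topology ($\mathcal A$ discrete) and the shift action $\tau_k(x)=x(\cdot-k)$, $k\in\mathbb Z$. A bi-sided subshift is a closed $\tau$-invariant subset $X\subset\mathcal A^{\mathbb Z}$. For a closed (possibly non-invariant) $N\subset X$ and $x\in N$, $\mathbb Z_x(N):=\{k\in\mathbb Z:\tau_k(x)\in N\}$, and $\mathsf H^N_x\in\mathbb B[\ell^2(\mathbb Z_x(N))]$ is defined by $[\mathsf H^N_x(v)](k)=\sum_{l\in\mathbb Z_x(N)}h(\tau_l(x),k-l)v(l)$, $k\in\mathbb Z_x(N)$. The Fell topology on the set $\mathrm{Cl}(X)$ of closed subsets of $X$ has basic open sets $\{A:A\cap K=\emptyset,\ A\cap\mathcal O\ne\emptyset\ \forall\mathcal O\in\mathfrak O\}$, $K$ compact, $\mathfrak O$ a finite family of open sets. *)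

theory Defs
  imports "HOL-Analysis.Analysis"
begin

definition fullshift_top :: "(int \<Rightarrow> 'a) topology" where
  "fullshift_top = product_topology (\<lambda>_. discrete_topology UNIV) UNIV"

definition shift :: "int \<Rightarrow> (int \<Rightarrow> 'a) \<Rightarrow> (int \<Rightarrow> 'a)" where
  "shift k x = (\<lambda>n. x (n - k))"

definition subshift :: "(int \<Rightarrow> 'a) set \<Rightarrow> bool" where
  "subshift X \<longleftrightarrow> closedin fullshift_top X \<and> (\<forall>k. \<forall>x\<in>X. shift k x \<in> X)"

definition Zset :: "(int \<Rightarrow> 'a) set \<Rightarrow> (int \<Rightarrow> 'a) \<Rightarrow> int set" where
  "Zset N x = {k. shift k x \<in> N}"

definition l2 :: "int set \<Rightarrow> (int \<Rightarrow> complex) set" where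
  "l2 S = {v. (\<forall>k. k \<notin> S \<longrightarrow> v k = 0) \<and> (\<lambda>k. (cmod (v k))\<^sup>2) summable_on S}"

definition l2norm :: "int set \<Rightarrow> (int \<Rightarrow> complex) \<Rightarrow> real" where
  "l2norm S v = sqrt (infsum (\<lambda>k. (cmod (v k))\<^sup>2) S)"

definition Hop :: "((int \<Rightarrow> 'a) \<Rightarrow> int \<Rightarrow> complex) \<Rightarrow> (int \<Rightarrow> 'a) set \<Rightarrow> (int \<Rightarrow> 'a)
    \<Rightarrow> (int \<Rightarrow> complex) \<Rightarrow> (int \<Rightarrow> complex)" where
  "Hop h N x v = (\<lambda>k. if k \<in> Zset N x
       then infsum (\<lambda>l. h (shift l x) (k - l) * v l) (Zset N x) else 0)"

definition bounded_op_on :: "int set \<Rightarrow> ((int \<Rightarrow> complex) \<Rightarrow> (int \<Rightarrow> complex)) \<Rightarrow> bool" where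
  "bounded_op_on S R \<longleftrightarrow> (\<forall>v\<in>l2 S. R v \<in> l2 S)
     \<and> (\<forall>u\<in>l2 S. \<forall>w\<in>l2 S. \<forall>a b. R (\<lambda>k. a * u k + b * w k) = (\<lambda>k. a * R u k + b * R w k))
     \<and> (\<exists>C. \<forall>v\<in>l2 S. l2norm S (R v) \<le> C * l2norm S v)"

definition spectrum_on :: "int set \<Rightarrow> ((int \<Rightarrow> complex) \<Rightarrow> (int \<Rightarrow> complex)) \<Rightarrow> complex set" where
  "spectrum_on S T = {z. \<not> (\<exists>R. bounded_op_on S R
       \<and> (\<forall>v\<in>l2 S. R (\<lambda>k. T v k - z * v k) = v)
       \<and> (\<forall>v\<in>l2 S. (\<lambda>k. T (R v) k - z * R v k) = v))}"

text \<open>inf sp and sup sp (the spectrum of a self-adjoint operator is real).\<close>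
definition inf_sp :: "int set \<Rightarrow> ((int \<Rightarrow> complex) \<Rightarrow> (int \<Rightarrow> complex)) \<Rightarrow> real" where
  "inf_sp S T = Inf {r::real. complex_of_real r \<in> spectrum_on S T}"

definition sup_sp :: "int set \<Rightarrow> ((int \<Rightarrow> complex) \<Rightarrow> (int \<Rightarrow> complex)) \<Rightarrow> real" where
  "sup_sp S T = Sup {r::real. complex_of_real r \<in> spectrum_on S T}"

definition directed_set :: "'i set \<Rightarrow> ('i \<Rightarrow> 'i \<Rightarrow> bool) \<Rightarrow> bool" where
  "directed_set I le \<longleftrightarrow> I \<noteq> {} \<and> (\<forall>i\<in>I. le i i)
     \<and> (\<forall>i\<in>I. \<forall>j\<in>I. \<forall>k\<in>I. le i j \<longrightarrow> le j k \<longrightarrow> le i k)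
     \<and> (\<forall>i\<in>I. \<forall>j\<in>I. \<exists>k\<in>I. le i k \<and> le j k)"

definition net_eventually :: "'i set \<Rightarrow> ('i \<Rightarrow> 'i \<Rightarrow> bool) \<Rightarrow> ('i \<Rightarrow> bool) \<Rightarrow> bool" where
  "net_eventually I le P \<longleftrightarrow> (\<exists>i0\<in>I. \<forall>i\<in>I. le i0 i \<longrightarrow> P i)"

text \<open>Convergence of a net of closed subsets of the space (topology T) in the Fell topology:
  the net eventually lies in every basic open neighbourhood of the limit.\<close>
definition fell_converges :: "'b topology \<Rightarrow> 'i set \<Rightarrow> ('i \<Rightarrow> 'i \<Rightarrow> bool)
    \<Rightarrow> ('i \<Rightarrow> 'b set) \<Rightarrow> 'b set \<Rightarrow> bool" where
  "fell_converges T I le M L \<longleftrightarrow>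
     (\<forall>K Fam. compactin T K \<and> finite Fam \<and> (\<forall>U\<in>Fam. openin T U)
        \<and> L \<inter> K = {} \<and> (\<forall>U\<in>Fam. L \<inter> U \<noteq> {})
        \<longrightarrow> net_eventually I le (\<lambda>i. M i \<inter> K = {} \<and> (\<forall>U\<in>Fam. M i \<inter> U \<noteq> {})))"

end

theory Submission
  imports Defs
begin

text \<open>
  Since \<open>h\<close> has compact support, every operator involved is a self-adjoint band matrix of a
  common width \<open>L\<close> and common entry bound \<open>B\<close>, and the bottom of its spectrum is the largest
  \<open>c\<close> such that its quadratic form dominates \<open>c\<close> times the squared norm. For \<open>x\<close> in the
  invariant set \<open>Xinf\<close> the operators attached to \<open>Xinf\<close> and to \<open>M i\<close> coincide, which gives
  one inequality. For the other one, average the form over the cutoffs to all windows of length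
  \<open>W\<close>: this costs only \<open>O(1/W)\<close>. By Fell convergence some \<open>M i\<close> lies so close to \<open>Xinf\<close>
  that each window seen from a point of \<open>M i\<close> is almost a window seen from a point of \<open>Xinf\<close>,
  where the form is bounded below. The statement on suprema is the one on infima for \<open>- h\<close>.
\<close>

section \<open>Square-summable sequences\<close>

text \<open>The squared norm, summed over all integers: members of \<open>l2 S\<close> vanish off
  \<open>S\<close>, so one functional serves every \<open>S\<close>, and cutoffs and translates can
  be compared without tracking index sets.\<close>

definition nrm2 :: "(int \<Rightarrow> complex) \<Rightarrow> real" where
  "nrm2 v = (\<Sum>\<^sub>\<infinity>k. (cmod (v k))\<^sup>2)"

text \<open>Here \<open>\<bullet>\<close> is the real inner product of the plane, so this is the
  real part of the Hermitian inner product. It suffices, as the forms of symmetric operators are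
  real.\<close>

definition ip :: "(int \<Rightarrow> complex) \<Rightarrow> (int \<Rightarrow> complex) \<Rightarrow> real" where
  "ip u v = (\<Sum>\<^sub>\<infinity>k. u k \<bullet> v k)"

lemma l2_iff: "v \<in> l2 S \<longleftrightarrow> v \<in> l2 UNIV \<and> (\<forall>k. k \<notin> S \<longrightarrow> v k = 0)"
proof (cases "\<forall>k. k \<notin> S \<longrightarrow> v k = 0")
  case True
  then have "(\<lambda>k. (cmod (v k))\<^sup>2) summable_on S \<longleftrightarrow> (\<lambda>k. (cmod (v k))\<^sup>2) summable_on UNIV"
    by (intro summable_on_cong_neutral) auto
  with True show ?thesis by (auto simp: l2_def)
qed (auto simp: l2_def)

lemma l2_subset_UNIV: "v \<in> l2 S \<Longrightarrow> v \<in> l2 UNIV"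
  using l2_iff by blast

lemma l2_zero_outside: "v \<in> l2 S \<Longrightarrow> k \<notin> S \<Longrightarrow> v k = 0"
  using l2_iff by blast

lemma l2_summable: "v \<in> l2 S \<Longrightarrow> (\<lambda>k. (cmod (v k))\<^sup>2) summable_on UNIV"
  using l2_subset_UNIV by (auto simp: l2_def)

lemma l2norm_eq_sqrt_nrm2:
  assumes "v \<in> l2 S"
  shows "l2norm S v = sqrt (nrm2 v)"
proof -
  have "(\<Sum>\<^sub>\<infinity>k\<in>S. (cmod (v k))\<^sup>2) = (\<Sum>\<^sub>\<infinity>k. (cmod (v k))\<^sup>2)"
    using l2_zero_outside[OF assms] by (intro infsum_cong_neutral) auto
  then show ?thesis by (simp add: l2norm_def nrm2_def)
qed

lemma l2I_comparison:
  assumes "\<And>k. k \<notin> S \<Longrightarrow> v k = 0" and "f summable_on UNIV" and "\<And>k. (cmod (v k))\<^sup>2 \<le> f k"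
  shows "v \<in> l2 S"
proof -
  have "(\<lambda>k. (cmod (v k))\<^sup>2) summable_on UNIV"
    by (rule summable_on_comparison_test[OF assms(2)]) (use assms(3) in auto)
  then have "v \<in> l2 UNIV" by (simp add: l2_def)
  with assms(1) show ?thesis using l2_iff by blast
qed

lemma l2_finite_support:
  assumes "finite F" and "\<And>k. k \<notin> F \<Longrightarrow> v k = 0"
  shows "v \<in> l2 UNIV"
proof -
  have "(\<lambda>k. (cmod (v k))\<^sup>2) summable_on UNIV \<longleftrightarrow> (\<lambda>k. (cmod (v k))\<^sup>2) summable_on F"
    using assms by (intro summable_on_cong_neutral) auto
  with assms(1) show ?thesis by (simp add: l2_def)
qed

lemma sum_sq_le: "(x + y)\<^sup>2 \<le> 2 * x\<^sup>2 + 2 * (y::real)\<^sup>2"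
  using zero_le_power2[of "x - y"] by (simp add: power2_eq_square algebra_simps)

lemma l2_lincomb:
  assumes "u \<in> l2 S" "v \<in> l2 S"
  shows "(\<lambda>k. a * u k + b * v k) \<in> l2 S"
proof (rule l2I_comparison)
  show "(\<lambda>k. 2 * (cmod a)\<^sup>2 * (cmod (u k))\<^sup>2 + 2 * (cmod b)\<^sup>2 * (cmod (v k))\<^sup>2) summable_on UNIV"
    using assms[THEN l2_summable] by (intro summable_on_add summable_on_cmult_right)
  fix k
  have "(cmod (a * u k + b * v k))\<^sup>2 \<le> (cmod (a * u k) + cmod (b * v k))\<^sup>2"
    by (intro power_mono norm_triangle_ineq) auto
  also have "\<dots> \<le> 2 * (cmod (a * u k))\<^sup>2 + 2 * (cmod (b * v k))\<^sup>2" by (rule sum_sq_le)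
  finally show "(cmod (a * u k + b * v k))\<^sup>2
      \<le> 2 * (cmod a)\<^sup>2 * (cmod (u k))\<^sup>2 + 2 * (cmod b)\<^sup>2 * (cmod (v k))\<^sup>2"
    by (simp add: norm_mult power_mult_distrib)
qed (simp add: assms[THEN l2_zero_outside])

lemma l2_add_scaled:
  assumes "u \<in> l2 S" "v \<in> l2 S"
  shows "(\<lambda>k. u k + b * v k) \<in> l2 S"
  using l2_lincomb[OF assms, of 1 b] by simp

lemma ip_summable:
  assumes "u \<in> l2 S" "v \<in> l2 S'"
  shows "(\<lambda>k. u k \<bullet> v k) summable_on UNIV"
proof -
  have "(\<lambda>k. (cmod (u k))\<^sup>2 + (cmod (v k))\<^sup>2) summable_on UNIV"
    using assms by (intro summable_on_add l2_summable)
  then have "(\<lambda>k. norm (u k \<bullet> v k)) summable_on UNIV"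
  proof (rule summable_on_comparison_test)
    fix k
    have "\<bar>u k \<bullet> v k\<bar> \<le> cmod (u k) * cmod (v k)" by (rule Cauchy_Schwarz_ineq2)
    also have "\<dots> \<le> (cmod (u k))\<^sup>2 + (cmod (v k))\<^sup>2"
      using zero_le_power2[of "cmod (u k) - cmod (v k)"] zero_le_power2[of "cmod (u k)"]
        zero_le_power2[of "cmod (v k)"]
      unfolding power2_diff by linarith
    finally show "norm (u k \<bullet> v k) \<le> (cmod (u k))\<^sup>2 + (cmod (v k))\<^sup>2" by simp
  qed auto
  then show ?thesis by (rule abs_summable_summable)
qed

lemma nrm2_eq_ip: "nrm2 v = ip v v"
  by (simp add: nrm2_def ip_def power2_norm_eq_inner)

lemma ip_commute: "ip u v = ip v u"
  by (simp add: ip_def inner_commute)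

lemma nrm2_nonneg: "0 \<le> nrm2 v"
  unfolding nrm2_def by (intro infsum_nonneg) auto

lemma ip_add_scaled_left:
  assumes "u \<in> l2 S" "w \<in> l2 S" "v \<in> l2 S"
  shows "ip (\<lambda>k. u k + of_real a * w k) v = ip u v + a * ip w v"
proof -
  have "ip (\<lambda>k. u k + of_real a * w k) v = (\<Sum>\<^sub>\<infinity>k. u k \<bullet> v k + a * (w k \<bullet> v k))"
    unfolding ip_def by (simp add: inner_add_left scaleR_conv_of_real[symmetric])
  also have "\<dots> = ip u v + a * ip w v"
    unfolding ip_def
    by (subst infsum_add) (auto intro!: summable_on_cmult_right ip_summable assms simp: infsum_cmult_right')
  finally show ?thesis .
qed

lemma ip_add_scaled_right:
  assumes "u \<in> l2 S" "w \<in> l2 S" "v \<in> l2 S"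
  shows "ip v (\<lambda>k. u k + of_real a * w k) = ip v u + a * ip v w"
  using ip_add_scaled_left[OF assms] by (subst (1 2 3) ip_commute)

lemma nrm2_add_scaled:
  assumes "u \<in> l2 S" "w \<in> l2 S"
  shows "nrm2 (\<lambda>k. u k + of_real a * w k) = nrm2 u + 2 * a * ip u w + a\<^sup>2 * nrm2 w"
proof -
  let ?z = "\<lambda>k. u k + of_real a * w k"
  have z: "?z \<in> l2 S" by (intro l2_add_scaled assms)
  have "nrm2 ?z = ip u ?z + a * ip w ?z"
    unfolding nrm2_eq_ip using assms z by (rule ip_add_scaled_left)
  also have "ip u ?z = ip u u + a * ip w u"
    using ip_add_scaled_right[OF assms assms(1)] by (simp add: ip_commute[of w])
  also have "ip w ?z = ip u w + a * ip w w"
    using ip_add_scaled_right[OF assms assms(2)] by (simp add: ip_commute[of w u])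
  finally show ?thesis
    by (simp add: nrm2_eq_ip ip_commute[of w u] power2_eq_square algebra_simps)
qed

text \<open>Expand the squared norm of \<open>u - s * w\<close> and divide by \<open>s\<close>. This
  weighted inequality stands in for Cauchy-Schwarz and avoids square roots.\<close>

lemma ip_le_weighted:
  assumes "u \<in> l2 S" "w \<in> l2 S" "0 < s"
  shows "2 * ip u w \<le> s * nrm2 w + nrm2 u / s"
proof -
  have "0 \<le> nrm2 (\<lambda>k. u k + of_real (- s) * w k)" by (rule nrm2_nonneg)
  also have "\<dots> = nrm2 u - s * (2 * ip u w) + s\<^sup>2 * nrm2 w"
    using nrm2_add_scaled[OF assms(1,2), of "- s"] by simp
  finally have "s * (2 * ip u w) \<le> s * (s * nrm2 w + nrm2 u / s)"
    using assms(3) by (simp add: power2_eq_square algebra_simps)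
  with assms(3) show ?thesis by simp
qed

lemma sum_cmod_sq_le_nrm2:
  assumes "v \<in> l2 S" "finite F"
  shows "(\<Sum>k\<in>F. (cmod (v k))\<^sup>2) \<le> nrm2 v"
  unfolding nrm2_def using l2_summable[OF assms(1)] assms(2) by (intro finite_sum_le_infsum) auto

lemma cmod_sq_le_nrm2: "v \<in> l2 S \<Longrightarrow> (cmod (v k))\<^sup>2 \<le> nrm2 v"
  using sum_cmod_sq_le_nrm2[of v S "{k}"] by simp

lemma nrm2_eq_0D: "v \<in> l2 S \<Longrightarrow> nrm2 v \<le> 0 \<Longrightarrow> v = (\<lambda>_. 0)"
proof
  fix k assume "v \<in> l2 S" "nrm2 v \<le> 0"
  then have "(cmod (v k))\<^sup>2 \<le> 0" using cmod_sq_le_nrm2 order_trans by blast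
  then show "v k = 0" by simp
qed

section \<open>Finite interchanges and translations of sums over the integers\<close>

lemma has_sum_finite_sum:
  fixes f :: "'d \<Rightarrow> 'k \<Rightarrow> real"
  assumes "finite D" "\<And>d. d \<in> D \<Longrightarrow> f d summable_on A"
  shows "((\<lambda>k. \<Sum>d\<in>D. f d k) has_sum (\<Sum>d\<in>D. infsum (f d) A)) A"
  using assms by (induction D) (auto intro!: has_sum_add)

lemma infsum_finite_sum:
  fixes f :: "'d \<Rightarrow> 'k \<Rightarrow> real"
  assumes "finite D" "\<And>d. d \<in> D \<Longrightarrow> f d summable_on A"
  shows "(\<Sum>\<^sub>\<infinity>k\<in>A. \<Sum>d\<in>D. f d k) = (\<Sum>d\<in>D. infsum (f d) A)"
  using has_sum_finite_sum[OF assms] by (rule infsumI)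

lemma summable_on_finite_sum:
  fixes f :: "'d \<Rightarrow> 'k \<Rightarrow> real"
  assumes "finite D" "\<And>d. d \<in> D \<Longrightarrow> f d summable_on A"
  shows "(\<lambda>k. \<Sum>d\<in>D. f d k) summable_on A"
  using has_sum_finite_sum[OF assms] by (rule has_sum_imp_summable)

lemma bij_int_translation: "bij (\<lambda>k. k + d :: int)"
  by (rule bij_betw_byWitness[where f' = "\<lambda>k. k - d"]) auto

lemma infsum_translate: "(\<Sum>\<^sub>\<infinity>k::int. f (k + d)) = (\<Sum>\<^sub>\<infinity>k. f k)"
  by (rule infsum_reindex_bij_betw[OF bij_int_translation])

lemma summable_on_translate:
  "(\<lambda>k::int. f (k + d)) summable_on UNIV \<longleftrightarrow> f summable_on UNIV"
  by (rule summable_on_reindex_bij_betw[OF bij_int_translation])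

lemma l2_translate: "(\<lambda>k. v (k + d)) \<in> l2 UNIV \<longleftrightarrow> v \<in> l2 UNIV"
  using summable_on_translate[of "\<lambda>k. (cmod (v k))\<^sup>2" d] by (simp add: l2_def)

lemma nrm2_translate: "nrm2 (\<lambda>k. v (k + d)) = nrm2 v"
  unfolding nrm2_def by (rule infsum_translate[where f = "\<lambda>k. (cmod (v k))\<^sup>2"])

lemma norm_sum_sq_le:
  assumes "finite D"
  shows "(cmod (\<Sum>d\<in>D. f d))\<^sup>2 \<le> real (card D) * (\<Sum>d\<in>D. (cmod (f d))\<^sup>2)"
proof -
  have "(cmod (\<Sum>d\<in>D. f d))\<^sup>2 \<le> (\<Sum>d\<in>D. cmod (f d))\<^sup>2"
    by (intro power_mono norm_sum) auto
  also have "\<dots> \<le> (\<Sum>d\<in>D. 1\<^sup>2) * (\<Sum>d\<in>D. (cmod (f d))\<^sup>2)"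
    using Cauchy_Schwarz_ineq_sum[of "\<lambda>_. 1" "\<lambda>d. cmod (f d)" D] by simp
  finally show ?thesis by simp
qed

section \<open>Self-adjoint band operators\<close>

text \<open>The matrix is stored by diagonals: \<open>b d k\<close> is the entry in row
  \<open>k\<close> and column \<open>k - d\<close>. Only the output is cut to \<open>S\<close>; the
  input vanishes off \<open>S\<close> when it lies in \<open>l2 S\<close>.\<close>

definition band :: "int set \<Rightarrow> int \<Rightarrow> (int \<Rightarrow> int \<Rightarrow> complex) \<Rightarrow> (int \<Rightarrow> complex) \<Rightarrow> (int \<Rightarrow> complex)" where
  "band S L b v = (\<lambda>k. if k \<in> S then \<Sum>d\<in>{-L..L}. b d k * v (k - d) else 0)"

locale selfadjoint_band =
  fixes S :: "int set" and L :: int and b :: "int \<Rightarrow> int \<Rightarrow> complex" and B :: real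
  assumes L_nonneg: "0 \<le> L"
    and entry_bound: "\<And>d k. cmod (b d k) \<le> B"
    and hermitian: "\<And>d k. cnj (b d (k + d)) = b (- d) k"
begin

abbreviation T where "T \<equiv> band S L b"
abbreviation D where "D \<equiv> {-L..L}"

lemma entry_term_l2:
  assumes "v \<in> l2 UNIV"
  shows "(\<lambda>k. b d k * v (k - d)) \<in> l2 UNIV" "nrm2 (\<lambda>k. b d k * v (k - d)) \<le> B\<^sup>2 * nrm2 v"
proof -
  have v': "(\<lambda>k. v (k + - d)) \<in> l2 UNIV" using assms l2_translate by blast
  have le: "(cmod (b d k * v (k - d)))\<^sup>2 \<le> B\<^sup>2 * (cmod (v (k + - d)))\<^sup>2" for k
    using entry_bound[of d k] by (auto simp: norm_mult power_mult_distrib intro!: mult_right_mono power_mono)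
  have s: "(\<lambda>k. B\<^sup>2 * (cmod (v (k + - d)))\<^sup>2) summable_on UNIV"
    by (intro summable_on_cmult_right l2_summable[OF v'])
  show l2: "(\<lambda>k. b d k * v (k - d)) \<in> l2 UNIV"
    by (rule l2I_comparison[OF _ s le]) auto
  have "nrm2 (\<lambda>k. b d k * v (k - d)) \<le> (\<Sum>\<^sub>\<infinity>k. B\<^sup>2 * (cmod (v (k + - d)))\<^sup>2)"
    unfolding nrm2_def by (rule infsum_mono[OF l2_summable[OF l2] s le])
  also have "\<dots> = B\<^sup>2 * nrm2 v"
    using nrm2_translate[of v "-d"] by (simp add: infsum_cmult_right' nrm2_def)
  finally show "nrm2 (\<lambda>k. b d k * v (k - d)) \<le> B\<^sup>2 * nrm2 v" .
qed

text \<open>A bound for the square of the operator norm: \<open>card D\<close> diagonals, each of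
  norm at most \<open>B\<close>. The added 1 makes it positive, so that it can be a
  denominator.\<close>

definition K :: real where "K = (real (card D))\<^sup>2 * B\<^sup>2 + 1"

lemma K_pos: "0 < K"
  unfolding K_def by (intro add_nonneg_pos) auto

lemma T_bounded:
  assumes "v \<in> l2 UNIV"
  shows "T v \<in> l2 S" "nrm2 (T v) \<le> K * nrm2 v"
proof -
  let ?f = "\<lambda>k. real (card D) * (\<Sum>d\<in>D. (cmod (b d k * v (k - d)))\<^sup>2)"
  have s1: "(\<lambda>k. (cmod (b d k * v (k - d)))\<^sup>2) summable_on UNIV" for d
    by (rule l2_summable[OF entry_term_l2(1)[OF assms]])
  have s: "?f summable_on UNIV"
    by (intro summable_on_cmult_right summable_on_finite_sum s1) simp
  have le: "(cmod (T v k))\<^sup>2 \<le> ?f k" for k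
  proof (cases "k \<in> S")
    case True
    then show ?thesis unfolding band_def using norm_sum_sq_le[of D "\<lambda>d. b d k * v (k - d)"] by simp
  next
    case False
    then show ?thesis by (simp add: band_def sum_nonneg)
  qed
  show TV: "T v \<in> l2 S" by (rule l2I_comparison[OF _ s le]) (simp add: band_def)
  have "nrm2 (T v) \<le> infsum ?f UNIV"
    unfolding nrm2_def by (rule infsum_mono[OF l2_summable[OF TV] s le])
  also have "\<dots> = real (card D) * (\<Sum>d\<in>D. nrm2 (\<lambda>k. b d k * v (k - d)))"
    unfolding nrm2_def using s1 by (simp add: infsum_cmult_right' infsum_finite_sum)
  also have "\<dots> \<le> real (card D) * (\<Sum>d\<in>D. B\<^sup>2 * nrm2 v)"
    by (intro mult_left_mono sum_mono entry_term_l2 assms) auto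
  also have "\<dots> \<le> K * nrm2 v"
    using nrm2_nonneg[of v] by (simp add: K_def power2_eq_square algebra_simps)
  finally show "nrm2 (T v) \<le> K * nrm2 v" .
qed

lemma T_lincomb: "T (\<lambda>k. a * u k + c * w k) = (\<lambda>k. a * T u k + c * T w k)"
  by (auto simp: band_def fun_eq_iff sum.distrib sum_distrib_left algebra_simps)

lemma T_add_scaled: "T (\<lambda>k. u k + c * w k) = (\<lambda>k. T u k + c * T w k)"
  using T_lincomb[of 1 u c w] by simp

text \<open>Since \<open>v\<close> vanishes off \<open>S\<close>, the cutoff in \<open>band\<close>
  has no effect, and the right-hand side no longer mentions \<open>S\<close>.\<close>

lemma ip_T:
  assumes "u \<in> l2 UNIV" "v \<in> l2 S"
  shows "ip (T u) v = (\<Sum>d\<in>D. \<Sum>\<^sub>\<infinity>k. (b d k * u (k - d)) \<bullet> v k)"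
proof -
  have "T u k \<bullet> v k = (\<Sum>d\<in>D. (b d k * u (k - d)) \<bullet> v k)" for k
    using l2_zero_outside[OF assms(2), of k] by (simp add: band_def inner_sum_left)
  then have "ip (T u) v = (\<Sum>\<^sub>\<infinity>k. \<Sum>d\<in>D. (b d k * u (k - d)) \<bullet> v k)"
    by (simp add: ip_def)
  also have "\<dots> = (\<Sum>d\<in>D. \<Sum>\<^sub>\<infinity>k. (b d k * u (k - d)) \<bullet> v k)"
    by (intro infsum_finite_sum ip_summable[OF entry_term_l2(1)[OF assms(1)] assms(2)]) simp
  finally show ?thesis .
qed

text \<open>Translating by \<open>d\<close> matches the \<open>d\<close>-th diagonal with the
  \<open>- d\<close>-th through \<open>hermitian\<close>; the reflection of \<open>D\<close> then
  restores the order of summation.\<close>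

lemma T_symmetric:
  assumes "u \<in> l2 S" "v \<in> l2 S"
  shows "ip (T u) v = ip u (T v)"
proof -
  have "(\<Sum>\<^sub>\<infinity>k. (b d k * u (k - d)) \<bullet> v k) = (\<Sum>\<^sub>\<infinity>k. (b (- d) k * v (k - - d)) \<bullet> u k)" for d
  proof -
    have "(b d (k + d) * u k) \<bullet> v (k + d) = (b (- d) k * v (k + d)) \<bullet> u k" for k
      unfolding hermitian[symmetric] by (simp add: inner_complex_def algebra_simps)
    then show ?thesis
      using infsum_translate[of "\<lambda>k. (b d k * u (k - d)) \<bullet> v k" d] by simp
  qed
  then have "ip (T u) v = (\<Sum>d\<in>D. \<Sum>\<^sub>\<infinity>k. (b (- d) k * v (k - - d)) \<bullet> u k)"
    using ip_T[OF l2_subset_UNIV[OF assms(1)] assms(2)] by simp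
  also have "\<dots> = (\<Sum>d\<in>D. \<Sum>\<^sub>\<infinity>k. (b d k * v (k - d)) \<bullet> u k)"
    by (rule sum.reindex_bij_witness[of _ uminus uminus]) auto
  also have "\<dots> = ip u (T v)"
    using ip_T[OF l2_subset_UNIV[OF assms(2)] assms(1)] by (simp add: ip_commute)
  finally show ?thesis .
qed

text \<open>Each row has finitely many entries, so pointwise convergence is enough.\<close>

lemma T_pointwise_limit:
  assumes "\<And>k. (\<lambda>n. u n k) \<longlonglongrightarrow> w k"
  shows "(\<lambda>n. T (u n) k) \<longlonglongrightarrow> T w k"
proof (cases "k \<in> S")
  case True
  have "(\<lambda>n. \<Sum>d\<in>D. b d k * u n (k - d)) \<longlonglongrightarrow> (\<Sum>d\<in>D. b d k * w (k - d))"
    by (intro tendsto_sum tendsto_mult_left assms)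
  with True show ?thesis by (simp add: band_def)
qed (simp add: band_def)

text \<open>The weighted inequality with weight \<open>c\<close>: half of the upper bound for
  \<open>2 * ip (T v) v\<close> is absorbed by coercivity.\<close>

lemma coercive_norm_bound:
  assumes "0 < c" "\<forall>v\<in>l2 S. c * nrm2 v \<le> ip (T v) v" "v \<in> l2 S"
  shows "c\<^sup>2 * nrm2 v \<le> nrm2 (T v)"
proof -
  have "2 * ip (T v) v \<le> c * nrm2 v + nrm2 (T v) / c"
    by (intro ip_le_weighted[of _ S] T_bounded l2_subset_UNIV[OF assms(3)] assms)
  with assms have "c * nrm2 v \<le> nrm2 (T v) / c" by fastforce
  with assms(1) show ?thesis by (simp add: field_simps power2_eq_square)
qed

text \<open>Richardson iteration with step \<open>c / K\<close>: its residuals contract by the factor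
  \<open>1 - c\<^sup>2 / K\<close> in \<open>nrm2\<close>, and coercivity bounds the iterates uniformly, so that the
  pointwise limit is again square summable.\<close>

lemma coercive_solvable:
  assumes c: "0 < c" and coer: "\<forall>v\<in>l2 S. c * nrm2 v \<le> ip (T v) v" and v: "v \<in> l2 S"
  shows "\<exists>u\<in>l2 S. T u = v"
proof -
  define t where "t = c / K"
  \<comment> \<open>The maximum with 0 guarantees that \<open>sqrt q\<close> is a genuine ratio:
    \<open>c\<^sup>2 \<le> K\<close> can fail when \<open>S\<close> is empty, where coercivity holds
    for every \<open>c\<close>.\<close>
  define q where "q = max 0 (1 - c\<^sup>2 / K)"
  have t: "0 < t" using c K_pos by (simp add: t_def)
  have q: "0 \<le> q" "q < 1" using c K_pos by (auto simp: q_def)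
  define r where "r n = ((\<lambda>w k. w k + of_real (- t) * T w k) ^^ n) v" for n
  have r_Suc: "r (Suc n) = (\<lambda>k. r n k + of_real (- t) * T (r n) k)" for n by (simp add: r_def)
  have r_l2: "r n \<in> l2 S" for n
  proof (induction n)
    case 0 then show ?case using v by (simp add: r_def)
  next
    case (Suc n)
    then show ?case unfolding r_Suc
      by (intro l2_add_scaled T_bounded) (auto intro: l2_subset_UNIV)
  qed
  have contract: "nrm2 (r (Suc n)) \<le> q * nrm2 (r n)" for n
  proof -
    have 1: "t * (c * nrm2 (r n)) \<le> t * ip (T (r n)) (r n)"
      using coer r_l2 t by (intro mult_left_mono) auto
    have 2: "t\<^sup>2 * nrm2 (T (r n)) \<le> t\<^sup>2 * (K * nrm2 (r n))"
      by (intro mult_left_mono T_bounded l2_subset_UNIV[OF r_l2]) auto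
    have "nrm2 (r (Suc n)) = nrm2 (r n) + 2 * (- t) * ip (r n) (T (r n)) + (- t)\<^sup>2 * nrm2 (T (r n))"
      unfolding r_Suc by (intro nrm2_add_scaled[of _ S] r_l2 T_bounded l2_subset_UNIV[OF r_l2])
    also have "\<dots> \<le> nrm2 (r n) - 2 * (t * (c * nrm2 (r n))) + t\<^sup>2 * (K * nrm2 (r n))"
      using 1 2 by (simp add: ip_commute[of "r n"])
    also have "\<dots> = (1 - c\<^sup>2 / K) * nrm2 (r n)"
      using K_pos by (simp add: t_def power2_eq_square field_simps)
    also have "\<dots> \<le> q * nrm2 (r n)"
      by (intro mult_right_mono nrm2_nonneg) (simp add: q_def)
    finally show ?thesis .
  qed
  have r_bound: "nrm2 (r n) \<le> q ^ n * nrm2 v" for n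
  proof (induction n)
    case 0 then show ?case by (simp add: r_def)
  next
    case (Suc n)
    have "nrm2 (r (Suc n)) \<le> q * nrm2 (r n)" by (rule contract)
    also have "\<dots> \<le> q * (q ^ n * nrm2 v)" by (intro mult_left_mono Suc q)
    finally show ?case by simp
  qed
  have r_ptw: "cmod (r n k) \<le> sqrt q ^ n * sqrt (nrm2 v)" for n k
  proof -
    have "(cmod (r n k))\<^sup>2 \<le> q ^ n * nrm2 v"
      using cmod_sq_le_nrm2[OF r_l2] r_bound order_trans by blast
    then have "cmod (r n k) \<le> sqrt (q ^ n * nrm2 v)" by (rule real_le_rsqrt)
    then show ?thesis by (simp add: real_sqrt_mult real_sqrt_power)
  qed
  have sq: "sqrt q < 1" "0 \<le> sqrt q" using q by auto
  have geo: "summable (\<lambda>n. sqrt q ^ n * sqrt (nrm2 v))"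
    using sq by (intro summable_mult2 summable_geometric) auto
  have r_summable: "summable (\<lambda>n. r n k)" for k
    by (rule summable_comparison_test[OF _ geo]) (use r_ptw in auto)
  define p where "p n = (\<lambda>k. of_real t * (\<Sum>m<n. r m k))" for n
  define u where "u = (\<lambda>k. of_real t * (\<Sum>m. r m k))"
  have p_lim: "(\<lambda>n. p n k) \<longlonglongrightarrow> u k" for k
    unfolding p_def u_def by (intro tendsto_intros summable_LIMSEQ r_summable)
  have p_Suc: "p (Suc n) = (\<lambda>k. p n k + of_real t * r n k)" for n
    by (simp add: p_def algebra_simps)
  have p_l2: "p n \<in> l2 S" for n
  proof (induction n)
    case 0 then show ?case by (simp add: p_def l2_def)
  next
    case (Suc n) then show ?case unfolding p_Suc by (intro l2_add_scaled r_l2)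
  qed
  have Tp: "T (p n) = (\<lambda>k. v k + of_real (- 1) * r n k)" for n
  proof (induction n)
    case 0 then show ?case by (simp add: p_def r_def band_def fun_eq_iff)
  next
    case (Suc n) then show ?case unfolding p_Suc T_add_scaled by (simp add: r_Suc fun_eq_iff)
  qed
  have p_bound: "nrm2 (p n) \<le> 4 * nrm2 v / c\<^sup>2" for n
  proof -
    have "nrm2 (r n) \<le> 1 * nrm2 v"
      using r_bound[of n] q power_le_one[of q n] nrm2_nonneg[of v]
      by (meson mult_right_mono less_imp_le order_trans)
    moreover have "nrm2 (T (p n)) = nrm2 v - 2 * ip v (r n) + nrm2 (r n)"
      unfolding Tp using nrm2_add_scaled[OF v r_l2, of "- 1"] by simp
    \<comment> \<open>Adding the squared norm of \<open>v + r n\<close> to that of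
      \<open>v - r n\<close> gives the parallelogram bound
      \<open>2 * nrm2 v + 2 * nrm2 (r n)\<close>; this is the source of the factor 4.\<close>
    moreover have "0 \<le> nrm2 v + 2 * ip v (r n) + nrm2 (r n)"
      using nrm2_add_scaled[OF v r_l2, of 1 n] nrm2_nonneg[of "\<lambda>k. v k + of_real 1 * r n k"] by simp
    ultimately have "nrm2 (T (p n)) \<le> 4 * nrm2 v" by linarith
    with coercive_norm_bound[OF c coer p_l2] have "c\<^sup>2 * nrm2 (p n) \<le> 4 * nrm2 v" by (rule order_trans)
    with c show ?thesis by (simp add: field_simps)
  qed
  \<comment> \<open>A Fatou argument: finite sums commute with the pointwise limit, so the uniform
    bound on the iterates passes to every finite partial sum for \<open>u\<close>.\<close>
  have "(\<Sum>k\<in>F. (cmod (u k))\<^sup>2) \<le> 4 * nrm2 v / c\<^sup>2" if "finite F" for F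
  proof (rule LIMSEQ_le_const2)
    show "(\<lambda>n. \<Sum>k\<in>F. (cmod (p n k))\<^sup>2) \<longlonglongrightarrow> (\<Sum>k\<in>F. (cmod (u k))\<^sup>2)"
      by (intro tendsto_intros p_lim)
    show "\<exists>N. \<forall>n\<ge>N. (\<Sum>k\<in>F. (cmod (p n k))\<^sup>2) \<le> 4 * nrm2 v / c\<^sup>2"
      using sum_cmod_sq_le_nrm2[OF p_l2 that] p_bound order_trans by blast
  qed
  then have "(\<lambda>k. (cmod (u k))\<^sup>2) summable_on UNIV"
    by (intro nonneg_bdd_above_summable_on bdd_aboveI2) auto
  moreover have "u k = 0" if "k \<notin> S" for k
    unfolding u_def using l2_zero_outside[OF r_l2 that] by simp
  ultimately have "u \<in> l2 S" using l2_iff[of u S] by (simp add: l2_def)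
  moreover have "T u k = v k" for k
  proof -
    have "(\<lambda>n. T (p n) k) \<longlonglongrightarrow> T u k" by (rule T_pointwise_limit[OF p_lim])
    moreover have "(\<lambda>n. T (p n) k) \<longlonglongrightarrow> v k + of_real (- 1) * 0"
      unfolding Tp by (intro tendsto_intros summable_LIMSEQ_zero r_summable)
    ultimately show ?thesis using LIMSEQ_unique by fastforce
  qed
  ultimately show ?thesis by blast
qed

text \<open>The norm bound makes \<open>T\<close> injective, so any choice of preimages is
  automatically linear; the same bound gives the operator norm bound \<open>1 / c\<close> for the
  inverse.\<close>

lemma coercive_boundedly_invertible:
  assumes c: "0 < c" and coer: "\<forall>v\<in>l2 S. c * nrm2 v \<le> ip (T v) v"
  shows "\<exists>R. bounded_op_on S R \<and> (\<forall>v\<in>l2 S. R (T v) = v) \<and> (\<forall>v\<in>l2 S. T (R v) = v)"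
proof -
  have inj: "u = w" if "u \<in> l2 S" "w \<in> l2 S" "T u = T w" for u w
  proof -
    let ?z = "\<lambda>k. u k + (-1) * w k"
    have z: "?z \<in> l2 S" using that by (intro l2_add_scaled)
    have "T ?z = (\<lambda>_. 0)" unfolding T_add_scaled using that(3) by simp
    then have "c\<^sup>2 * nrm2 ?z \<le> 0"
      using coercive_norm_bound[OF c coer z] by (simp add: nrm2_def)
    then have "nrm2 ?z \<le> 0" using c by (simp add: mult_le_0_iff)
    from nrm2_eq_0D[OF z this] show ?thesis by (simp add: fun_eq_iff)
  qed
  obtain R where R: "R v \<in> l2 S" "T (R v) = v" if "v \<in> l2 S" for v
    using coercive_solvable[OF c coer] by metis
  have "bounded_op_on S R"
    unfolding bounded_op_on_def
  proof (intro conjI ballI allI exI[of _ "1 / c"])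
    fix u w a d assume uw: "u \<in> l2 S" "w \<in> l2 S"
    show "R (\<lambda>k. a * u k + d * w k) = (\<lambda>k. a * R u k + d * R w k)"
    proof (rule inj)
      show "T (R (\<lambda>k. a * u k + d * w k)) = T (\<lambda>k. a * R u k + d * R w k)"
        using uw by (simp add: R(2) T_lincomb l2_lincomb)
    qed (use uw in \<open>simp_all add: R(1) l2_lincomb\<close>)
  next
    fix v assume v: "v \<in> l2 S"
    have "c\<^sup>2 * nrm2 (R v) \<le> nrm2 v"
      using coercive_norm_bound[OF c coer R(1)[OF v]] R(2)[OF v] by simp
    then have "sqrt (c\<^sup>2 * nrm2 (R v)) \<le> sqrt (nrm2 v)" by simp
    then show "l2norm S (R v) \<le> 1 / c * l2norm S v"
      using c v R(1)[OF v] by (simp add: l2norm_eq_sqrt_nrm2 real_sqrt_mult field_simps)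
  qed (use R in auto)
  moreover have "R (T v) = v" if "v \<in> l2 S" for v
  proof (rule inj)
    have "T v \<in> l2 S" by (intro T_bounded l2_subset_UNIV[OF that])
    then show "R (T v) \<in> l2 S" "T (R (T v)) = T v" by (fact R)+
  qed (fact that)
  ultimately show ?thesis using R by blast
qed

text \<open>Test positivity on \<open>v - s * T v\<close> with \<open>s = 1 / (K + 1)\<close>; the
  term quadratic in \<open>s\<close> is at most \<open>s * nrm2 (T v)\<close>. The result is the
  operator inequality \<open>T\<^sup>2 \<le> (K + 1) * T\<close>, which turns lower bounds on the
  norm of \<open>T v\<close> into lower bounds on the form.\<close>

lemma nonneg_form_bound:
  assumes nn: "\<forall>v\<in>l2 S. 0 \<le> ip (T v) v" and v: "v \<in> l2 S"
  shows "nrm2 (T v) \<le> (K + 1) * ip (T v) v"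
proof -
  define M where "M = K + 1"
  define s where "s = 1 / M"
  have M: "0 < M" using K_pos by (simp add: M_def)
  have Tv: "T v \<in> l2 S" and TTv: "T (T v) \<in> l2 S"
    by (intro T_bounded l2_subset_UNIV[of _ S] v)+
  let ?w = "\<lambda>k. v k + of_real (- s) * T v k"
  have w: "?w \<in> l2 S" by (intro l2_add_scaled v Tv)
  have Tw: "T ?w = (\<lambda>k. T v k + of_real (- s) * T (T v) k)" by (rule T_add_scaled)
  have "0 \<le> ip (T ?w) ?w" using nn w by blast
  also have "\<dots> = ip (T v) ?w - s * ip (T (T v)) ?w"
    unfolding Tw using ip_add_scaled_left[OF Tv TTv w, of "- s"] by simp
  also have "ip (T v) ?w = ip (T v) v - s * nrm2 (T v)"
    using ip_add_scaled_right[OF v Tv Tv, of "- s"] by (simp add: nrm2_eq_ip)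
  also have "ip (T (T v)) ?w = nrm2 (T v) - s * ip (T (T v)) (T v)"
    using ip_add_scaled_right[OF v Tv TTv, of "- s"] T_symmetric[OF Tv v] by (simp add: nrm2_eq_ip)
  finally have 1: "0 \<le> ip (T v) v - 2 * s * nrm2 (T v) + s\<^sup>2 * ip (T (T v)) (T v)"
    by (simp add: power2_eq_square algebra_simps)
  have "2 * ip (T (T v)) (T v) \<le> nrm2 (T v) + nrm2 (T (T v))"
    using ip_le_weighted[OF TTv Tv, of 1] by simp
  moreover have "nrm2 (T (T v)) \<le> K * nrm2 (T v)"
    by (intro T_bounded l2_subset_UNIV[OF Tv])
  ultimately have "2 * ip (T (T v)) (T v) \<le> M * nrm2 (T v)"
    by (simp add: M_def algebra_simps)
  then have "ip (T (T v)) (T v) \<le> M * nrm2 (T v)"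
    using mult_nonneg_nonneg[OF less_imp_le[OF M] nrm2_nonneg[of "T v"]] by linarith
  then have "s\<^sup>2 * ip (T (T v)) (T v) \<le> s\<^sup>2 * (M * nrm2 (T v))"
    by (intro mult_left_mono) auto
  also have "\<dots> = s * nrm2 (T v)" using M by (simp add: s_def power2_eq_square)
  finally have "s * nrm2 (T v) \<le> ip (T v) v" using 1 by linarith
  then show ?thesis using M unfolding s_def M_def by (simp add: field_simps)
qed

section \<open>Scalar shifts and the bottom of the spectrum\<close>

lemma T_minus_scalar:
  assumes "v \<in> l2 S"
  shows "(\<lambda>k. T v k - of_real r * v k)
    = band S L (\<lambda>d k. b d k - (if d = 0 then of_real r else 0)) v"
proof
  fix k
  show "T v k - of_real r * v k = band S L (\<lambda>d k. b d k - (if d = 0 then of_real r else 0)) v k"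
  proof (cases "k \<in> S")
    case True
    have "(\<Sum>d\<in>D. (if d = 0 then complex_of_real r else 0) * v (k - d))
        = (\<Sum>d\<in>D. if d = 0 then of_real r * v k else 0)"
      by (rule sum.cong) auto
    also have "\<dots> = of_real r * v k" using L_nonneg by (simp add: sum.delta)
    finally show ?thesis using True by (simp add: band_def left_diff_distrib sum_subtractf)
  next
    case False
    with l2_zero_outside[OF assms] show ?thesis by (simp add: band_def)
  qed
qed

text \<open>Only the main diagonal changes, and it stays Hermitian because \<open>r\<close> is real.
  Hence everything proved in the locale also applies to \<open>T - r\<close>.\<close>

lemma shifted_selfadjoint_band:
  "selfadjoint_band L (\<lambda>d k. b d k - (if d = 0 then of_real r else 0)) (B + \<bar>r\<bar>)"
proof
  fix d k
  have "cmod (b d k - (if d = 0 then of_real r else 0)) \<le> cmod (b d k) + cmod (if d = 0 then of_real r else 0)"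
    by (rule norm_triangle_ineq4)
  also have "\<dots> \<le> B + \<bar>r\<bar>" by (intro add_mono entry_bound) auto
  finally show "cmod (b d k - (if d = 0 then of_real r else 0)) \<le> B + \<bar>r\<bar>" .
  show "cnj (b d (k + d) - (if d = 0 then of_real r else 0)) = b (- d) k - (if - d = 0 then of_real r else 0)"
    using hermitian[of d k] by auto
qed (rule L_nonneg)

lemma ip_T_minus_scalar:
  assumes "v \<in> l2 S"
  shows "ip (\<lambda>k. T v k - of_real r * v k) v = ip (T v) v - r * nrm2 v"
  using ip_add_scaled_left[OF T_bounded(1)[OF l2_subset_UNIV[OF assms]] assms assms, of "- r"]
  by (simp add: nrm2_eq_ip)

text \<open>The shifted operator \<open>T - r\<close> is coercive with constant
  \<open>c - r\<close>, hence boundedly invertible.\<close>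

lemma below_form_not_in_spectrum:
  assumes "r < c" "\<forall>v\<in>l2 S. c * nrm2 v \<le> ip (T v) v"
  shows "complex_of_real r \<notin> spectrum_on S T"
proof -
  define b' where "b' = (\<lambda>d k. b d k - (if d = 0 then complex_of_real r else 0))"
  interpret A: selfadjoint_band S L b' "B + \<bar>r\<bar>"
    unfolding b'_def by (rule shifted_selfadjoint_band)
  have A: "A.T v = (\<lambda>k. T v k - of_real r * v k)" if "v \<in> l2 S" for v
    using T_minus_scalar[OF that] by (simp add: b'_def)
  have "\<forall>v\<in>l2 S. (c - r) * nrm2 v \<le> ip (A.T v) v"
    using assms by (simp add: A ip_T_minus_scalar left_diff_distrib)
  from A.coercive_boundedly_invertible[OF _ this] assms(1) obtain R where
    R: "bounded_op_on S R" "\<forall>v\<in>l2 S. R (A.T v) = v" "\<forall>v\<in>l2 S. A.T (R v) = v" by auto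
  then have "R v \<in> l2 S" if "v \<in> l2 S" for v using that by (auto simp: bounded_op_on_def)
  with R have "\<forall>v\<in>l2 S. R (\<lambda>k. T v k - of_real r * v k) = v"
    "\<forall>v\<in>l2 S. (\<lambda>k. T (R v) k - of_real r * R v k) = v" by (auto simp: A)
  with R(1) show ?thesis unfolding spectrum_on_def by blast
qed

text \<open>A bounded inverse bounds \<open>v\<close> by \<open>(T - r) v\<close> in norm. As
  \<open>T - r\<close> has a nonnegative form, \<open>nonneg_form_bound\<close> upgrades this to a
  lower bound on the form, which improves \<open>r\<close> by \<open>1 / G\<close>.\<close>

lemma gap_of_not_in_spectrum:
  assumes "complex_of_real r \<notin> spectrum_on S T" "\<forall>v\<in>l2 S. r * nrm2 v \<le> ip (T v) v"
  shows "\<exists>c>r. \<forall>v\<in>l2 S. c * nrm2 v \<le> ip (T v) v"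
proof -
  define b' where "b' = (\<lambda>d k. b d k - (if d = 0 then complex_of_real r else 0))"
  interpret A: selfadjoint_band S L b' "B + \<bar>r\<bar>"
    unfolding b'_def by (rule shifted_selfadjoint_band)
  have A: "A.T v = (\<lambda>k. T v k - of_real r * v k)" if "v \<in> l2 S" for v
    using T_minus_scalar[OF that] by (simp add: b'_def)
  obtain R C where R: "\<forall>v\<in>l2 S. l2norm S (R v) \<le> C * l2norm S v" "\<forall>v\<in>l2 S. R (A.T v) = v"
    using assms(1) unfolding spectrum_on_def bounded_op_on_def by (auto simp: A)
  have nn: "\<forall>v\<in>l2 S. 0 \<le> ip (A.T v) v"
    using assms(2) by (simp add: A ip_T_minus_scalar)
  define G where "G = (C\<^sup>2 + 1) * (A.K + 1)"
  have G: "0 < G" unfolding G_def using A.K_pos by (intro mult_pos_pos add_nonneg_pos) auto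
  have "(r + 1 / G) * nrm2 v \<le> ip (T v) v" if v: "v \<in> l2 S" for v
  proof -
    have Av: "A.T v \<in> l2 S" by (intro A.T_bounded l2_subset_UNIV[OF v])
    have "sqrt (nrm2 v) \<le> C * sqrt (nrm2 (A.T v))"
      using R Av v by (metis l2norm_eq_sqrt_nrm2)
    then have "(sqrt (nrm2 v))\<^sup>2 \<le> (C * sqrt (nrm2 (A.T v)))\<^sup>2"
      by (intro power_mono) (auto simp: nrm2_nonneg)
    then have "nrm2 v \<le> C\<^sup>2 * nrm2 (A.T v)" by (simp add: nrm2_nonneg power_mult_distrib)
    also have "\<dots> \<le> (C\<^sup>2 + 1) * nrm2 (A.T v)" by (intro mult_right_mono nrm2_nonneg) auto
    also have "\<dots> \<le> (C\<^sup>2 + 1) * ((A.K + 1) * ip (A.T v) v)"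
      by (intro mult_left_mono A.nonneg_form_bound nn v) auto
    finally have "nrm2 v \<le> G * (ip (T v) v - r * nrm2 v)"
      using v by (simp add: G_def A ip_T_minus_scalar)
    then have "nrm2 v / G \<le> ip (T v) v - r * nrm2 v" using G by (simp add: field_simps)
    then show ?thesis by (simp add: algebra_simps)
  qed
  moreover have "r < r + 1 / G" using G by simp
  ultimately show ?thesis by blast
qed

text \<open>Let \<open>m\<close> be the best constant in the form bound. Nothing below
  \<open>m\<close> is spectral, and \<open>m\<close> itself is, since otherwise the gap lemma would
  give a better constant; so the infimum is a minimum. For empty \<open>S\<close> the spectrum is
  empty and \<open>Inf\<close> would carry no information.\<close>

lemma le_inf_sp_iff:
  assumes "S \<noteq> {}"
  shows "c \<le> inf_sp S T \<longleftrightarrow> (\<forall>v\<in>l2 S. c * nrm2 v \<le> ip (T v) v)"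
proof -
  define C where "C = {c. \<forall>v\<in>l2 S. c * nrm2 v \<le> ip (T v) v}"
  define m where "m = Sup C"
  obtain k0 where k0: "k0 \<in> S" using assms by blast
  \<comment> \<open>A unit vector supported in \<open>S\<close>: its form value bounds all
    admissible constants from above.\<close>
  define e where "e = (\<lambda>k. if k = k0 then 1 else 0 :: complex)"
  have e: "e \<in> l2 S"
    using k0 l2_finite_support[of "{k0}" e] l2_iff[of e S] by (auto simp: e_def)
  have "(\<Sum>\<^sub>\<infinity>k. (cmod (e k))\<^sup>2) = (\<Sum>\<^sub>\<infinity>k\<in>{k0}. (cmod (e k))\<^sup>2)"
    by (intro infsum_cong_neutral) (auto simp: e_def)
  then have ne: "nrm2 e = 1" by (simp add: nrm2_def e_def)
  \<comment> \<open>A crude admissible constant, from expanding the squared norm of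
    \<open>T v + v\<close>; it shows that \<open>C\<close> is nonempty.\<close>
  have "- (K + 1) * nrm2 v \<le> ip (T v) v" if v: "v \<in> l2 S" for v
  proof -
    have Tv: "T v \<in> l2 S" "nrm2 (T v) \<le> K * nrm2 v"
      by (intro T_bounded l2_subset_UNIV[OF v])+
    have "0 \<le> nrm2 (\<lambda>k. T v k + of_real 1 * v k)" by (rule nrm2_nonneg)
    also have "\<dots> = nrm2 (T v) + 2 * ip (T v) v + nrm2 v"
      using nrm2_add_scaled[OF Tv(1) v, of 1] by simp
    finally have "- (K + 1) * nrm2 v \<le> 2 * ip (T v) v" using Tv(2) by (simp add: algebra_simps)
    moreover have "0 \<le> (K + 1) * nrm2 v" using K_pos nrm2_nonneg by simp
    ultimately show ?thesis unfolding mult_minus_left by linarith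
  qed
  then have C_ne: "C \<noteq> {}" unfolding C_def by blast
  have C_bdd: "bdd_above C" unfolding C_def using e ne by (intro bdd_aboveI[of _ "ip (T e) e"]) auto
  have m_in: "m \<in> C"
    unfolding C_def
  proof (intro CollectI ballI)
    fix v assume v: "v \<in> l2 S"
    show "m * nrm2 v \<le> ip (T v) v"
    proof (cases "nrm2 v = 0")
      case True
      obtain c where "c \<in> C" using C_ne by blast
      with v True show ?thesis unfolding C_def by fastforce
    next
      case False
      then have pos: "0 < nrm2 v" using nrm2_nonneg[of v] by simp
      have "m \<le> ip (T v) v / nrm2 v"
        unfolding m_def
        by (rule cSup_least[OF C_ne]) (use v pos in \<open>auto simp: C_def field_simps\<close>)
      with pos show ?thesis by (simp add: field_simps)
    qed
  qed
  have below: "complex_of_real r \<notin> spectrum_on S T" if "r < m" for r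
    using below_form_not_in_spectrum[OF that] m_in by (simp add: C_def)
  have "complex_of_real m \<in> spectrum_on S T"
  proof (rule ccontr)
    assume "\<not> ?thesis"
    from gap_of_not_in_spectrum[OF this] m_in obtain c where "c > m" "c \<in> C" by (auto simp: C_def)
    with cSup_upper[OF _ C_bdd, of c] show False by (simp add: m_def)
  qed
  then have inf: "inf_sp S T = m"
    unfolding inf_sp_def using below by (intro cInf_eq_minimum) (auto simp: not_less[symmetric])
  show ?thesis
  proof
    assume "c \<le> inf_sp S T"
    then have "c * nrm2 v \<le> m * nrm2 v" for v by (intro mult_right_mono nrm2_nonneg) (simp add: inf)
    then show "\<forall>v\<in>l2 S. c * nrm2 v \<le> ip (T v) v" using m_in order_trans by (fastforce simp: C_def)
  next
    assume "\<forall>v\<in>l2 S. c * nrm2 v \<le> ip (T v) v"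
    then show "c \<le> inf_sp S T" unfolding inf m_def by (intro cSup_upper C_bdd) (simp add: C_def)
  qed
qed

end

section \<open>Localisation of quadratic forms\<close>

text \<open>The form of the full band matrix, without any set \<open>S\<close>. This lets operators
  attached to different sets be compared on the same vector.\<close>

definition qform :: "int \<Rightarrow> (int \<Rightarrow> int \<Rightarrow> complex) \<Rightarrow> (int \<Rightarrow> complex) \<Rightarrow> real" where
  "qform L b v = (\<Sum>d\<in>{-L..L}. \<Sum>\<^sub>\<infinity>k. (b d k * v (k - d)) \<bullet> v k)"

lemma qform_translate:
  "qform L (\<lambda>d k. b d (k + m)) (\<lambda>k. v (k + m)) = qform L b v"
  unfolding qform_def
proof (rule sum.cong[OF refl])
  fix d
  have *: "k - d + m = k + m - d" for k by simp
  show "(\<Sum>\<^sub>\<infinity>k. (b d (k + m) * v (k - d + m)) \<bullet> v (k + m)) = (\<Sum>\<^sub>\<infinity>k. (b d k * v (k - d)) \<bullet> v k)"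
    unfolding * by (rule infsum_translate)
qed

text \<open>Bound each term by the arithmetic-geometric mean inequality and use translation
  invariance of the norm. The bound on \<open>f\<close> is asked only where both factors of
  \<open>v\<close> are nonzero, because matrix entries will be known to be close only inside a
  window.\<close>

lemma diagonal_form_bound:
  assumes v: "v \<in> l2 UNIV"
    and le: "\<And>k. v k \<noteq> 0 \<Longrightarrow> v (k - d) \<noteq> 0 \<Longrightarrow> cmod (f k) \<le> \<eta>" and "0 \<le> \<eta>"
  shows "(\<lambda>k. (f k * v (k - d)) \<bullet> v k) summable_on UNIV"
    and "\<bar>\<Sum>\<^sub>\<infinity>k. (f k * v (k - d)) \<bullet> v k\<bar> \<le> \<eta> * nrm2 v"
proof -
  let ?f = "\<lambda>k. (f k * v (k - d)) \<bullet> v k"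
  let ?g = "\<lambda>k. \<eta> / 2 * ((cmod (v (k + - d)))\<^sup>2 + (cmod (v k))\<^sup>2)"
  have sv: "(\<lambda>k. (cmod (v (k + - d)))\<^sup>2) summable_on UNIV" "(\<lambda>k. (cmod (v k))\<^sup>2) summable_on UNIV"
    using l2_summable[OF v] summable_on_translate[of "\<lambda>k. (cmod (v k))\<^sup>2" "- d"] by auto
  have sg: "?g summable_on UNIV"
    by (intro summable_on_cmult_right summable_on_add sv)
  have fg: "\<bar>?f k\<bar> \<le> ?g k" for k
  proof (cases "v k \<noteq> 0 \<and> v (k - d) \<noteq> 0")
    case True
    have "\<bar>?f k\<bar> \<le> cmod (f k * v (k - d)) * cmod (v k)" by (rule Cauchy_Schwarz_ineq2)
    also have "\<dots> = cmod (f k) * (cmod (v (k - d)) * cmod (v k))" by (simp add: norm_mult)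
    also have "\<dots> \<le> \<eta> * (cmod (v (k - d)) * cmod (v k))"
      using True by (intro mult_right_mono le) auto
    also have "\<dots> \<le> \<eta> * (((cmod (v (k - d)))\<^sup>2 + (cmod (v k))\<^sup>2) / 2)"
      using zero_le_power2[of "cmod (v (k - d)) - cmod (v k)"] \<open>0 \<le> \<eta>\<close>
      by (intro mult_left_mono) (auto simp: power2_diff)
    finally show ?thesis by simp
  next
    case False
    then have "?f k = 0" by auto
    then show ?thesis using \<open>0 \<le> \<eta>\<close> by simp
  qed
  have "(\<lambda>k. norm (?f k)) summable_on UNIV"
    by (rule summable_on_comparison_test[OF sg]) (use fg in auto)
  then show sf: "?f summable_on UNIV" by (rule abs_summable_summable)
  have g: "infsum ?g UNIV = \<eta> * nrm2 v"
    unfolding infsum_cmult_right' infsum_add[OF sv]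
    using nrm2_translate[of v "- d"] by (simp add: nrm2_def)
  have "infsum ?f UNIV \<le> infsum ?g UNIV"
    by (rule infsum_mono[OF sf sg]) (rule abs_le_D1[OF fg])
  moreover have "infsum (\<lambda>k. - ?f k) UNIV \<le> infsum ?g UNIV"
    by (rule infsum_mono[OF summable_on_uminus[THEN iffD2, OF sf] sg]) (rule abs_le_D2[OF fg])
  ultimately show "\<bar>infsum ?f UNIV\<bar> \<le> \<eta> * nrm2 v"
    unfolding g infsum_uminus by (simp only: abs_le_iff)
qed

text \<open>Each of the \<open>2 * L + 1\<close> diagonals costs at most
  \<open>\<eta> * nrm2 v\<close>; the bound \<open>B\<close> supplies the summability that allows
  the two sums to be subtracted.\<close>

lemma qform_perturb:
  assumes v: "v \<in> l2 UNIV" and "0 \<le> L" "0 \<le> \<eta>" "0 \<le> B"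
    and bB: "\<And>d k. cmod (b d k) \<le> B" and b'B: "\<And>d k. cmod (b' d k) \<le> B"
    and le: "\<And>d k. d \<in> {-L..L} \<Longrightarrow> v k \<noteq> 0 \<Longrightarrow> v (k - d) \<noteq> 0 \<Longrightarrow> cmod (b d k - b' d k) \<le> \<eta>"
  shows "qform L b' v - (2 * of_int L + 1) * \<eta> * nrm2 v \<le> qform L b v"
proof -
  have "(\<Sum>\<^sub>\<infinity>k. (b' d k * v (k - d)) \<bullet> v k) - \<eta> * nrm2 v \<le> (\<Sum>\<^sub>\<infinity>k. (b d k * v (k - d)) \<bullet> v k)"
    if d: "d \<in> {-L..L}" for d
  proof -
    have s: "(\<lambda>k. (b d k * v (k - d)) \<bullet> v k) summable_on UNIV"
      "(\<lambda>k. (b' d k * v (k - d)) \<bullet> v k) summable_on UNIV"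
      by (rule diagonal_form_bound(1)[OF v _ \<open>0 \<le> B\<close>], rule bB)
        (rule diagonal_form_bound(1)[OF v _ \<open>0 \<le> B\<close>], rule b'B)
    have "\<bar>\<Sum>\<^sub>\<infinity>k. ((b d k - b' d k) * v (k - d)) \<bullet> v k\<bar> \<le> \<eta> * nrm2 v"
      using le[OF d] by (intro diagonal_form_bound v \<open>0 \<le> \<eta>\<close>)
    also have "(\<Sum>\<^sub>\<infinity>k. ((b d k - b' d k) * v (k - d)) \<bullet> v k)
        = (\<Sum>\<^sub>\<infinity>k. (b d k * v (k - d)) \<bullet> v k - (b' d k * v (k - d)) \<bullet> v k)"
      by (simp add: left_diff_distrib inner_diff_left)
    also have "\<dots> = (\<Sum>\<^sub>\<infinity>k. (b d k * v (k - d)) \<bullet> v k) - (\<Sum>\<^sub>\<infinity>k. (b' d k * v (k - d)) \<bullet> v k)"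
      using infsum_add[OF s(1) summable_on_uminus[THEN iffD2, OF s(2)]] by (simp add: infsum_uminus)
    finally show ?thesis by linarith
  qed
  then have "(\<Sum>d\<in>{-L..L}. (\<Sum>\<^sub>\<infinity>k. (b' d k * v (k - d)) \<bullet> v k) - \<eta> * nrm2 v) \<le> qform L b v"
    unfolding qform_def by (rule sum_mono)
  then show ?thesis
    using \<open>0 \<le> L\<close> by (simp add: qform_def sum_subtractf algebra_simps)
qed

text \<open>The forms of the sharp cutoffs of \<open>v\<close> to all windows of length \<open>W\<close> add up to
  \<open>\<Sum>d. (W - \<bar>d\<bar>) * G d\<close>, where \<open>G d\<close> is the contribution of the \<open>d\<close>-th diagonal: a pair of
  sites at distance \<open>\<bar>d\<bar>\<close> lies in exactly \<open>W - \<bar>d\<bar>\<close> windows.\<close>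

lemma qform_localize:
  assumes v: "v \<in> l2 UNIV" and L: "0 \<le> L" "L < W" and bB: "\<And>d k. cmod (b d k) \<le> B" and B: "0 \<le> B"
    and windows: "\<And>j. c * nrm2 (\<lambda>k. if k \<in> {j..<j+W} then v k else 0)
        \<le> qform L b (\<lambda>k. if k \<in> {j..<j+W} then v k else 0)"
  shows "(c - of_int (\<Sum>d\<in>{-L..L}. \<bar>d\<bar>) * B / of_int W) * nrm2 v \<le> qform L b v"
proof -
  define g where "g d k = (b d k * v (k - d)) \<bullet> v k" for d k
  define G where "G d = (\<Sum>\<^sub>\<infinity>k. g d k)" for d
  \<comment> \<open>The positions \<open>a\<close> in \<open>{0..<W}\<close> for which
    \<open>a - d\<close> lies in \<open>{0..<W}\<close> too, for either sign of
    \<open>d\<close>.\<close>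
  define A where "A d = {max 0 d..<min W (W + d)}" for d :: int
  define w where "w j = (\<lambda>k. if k \<in> {j..<j+W} then v k else 0)" for j
  have gs: "g d summable_on UNIV" and G: "\<bar>G d\<bar> \<le> B * nrm2 v" for d
    unfolding G_def g_def using v bB B by (intro diagonal_form_bound; blast)+
  have cardA: "of_nat (card (A d)) = (of_int W - of_int \<bar>d\<bar> :: real)" if "d \<in> {-L..L}" for d
    using that L by (auto simp: A_def of_nat_nat min_def max_def)
  have nw: "nrm2 (w j) = (\<Sum>a\<in>{0..<W}. (cmod (v (j + a)))\<^sup>2)" for j
  proof -
    have "nrm2 (w j) = (\<Sum>\<^sub>\<infinity>k\<in>{j..<j+W}. (cmod (v k))\<^sup>2)"
      unfolding nrm2_def w_def by (intro infsum_cong_neutral) auto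
    also have "\<dots> = (\<Sum>k\<in>{j..<j+W}. (cmod (v k))\<^sup>2)" by (rule infsum_finite) simp
    also have "\<dots> = (\<Sum>a\<in>{0..<W}. (cmod (v (j + a)))\<^sup>2)"
      by (rule sum.reindex_bij_witness[of _ "\<lambda>a. j + a" "\<lambda>k. k - j"]) auto
    finally show ?thesis .
  qed
  have qw: "qform L b (w j) = (\<Sum>d\<in>{-L..L}. \<Sum>a\<in>A d. g d (j + a))" for j
    unfolding qform_def
  proof (rule sum.cong[OF refl])
    fix d
    have "(\<Sum>\<^sub>\<infinity>k. (b d k * w j (k - d)) \<bullet> w j k) = (\<Sum>\<^sub>\<infinity>k\<in>(\<lambda>a. j + a) ` A d. g d k)"
    proof (rule infsum_cong_neutral)
      fix k assume "k \<in> UNIV - (\<lambda>a. j + a) ` A d"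
      then have "k - j \<notin> A d" by (metis DiffD2 add.commute diff_add_cancel image_eqI)
      then show "(b d k * w j (k - d)) \<bullet> w j k = 0" by (auto simp: w_def A_def)
    qed (auto simp: w_def A_def g_def)
    also have "\<dots> = (\<Sum>k\<in>(\<lambda>a. j + a) ` A d. g d k)" by (rule infsum_finite) (simp add: A_def)
    also have "\<dots> = (\<Sum>a\<in>A d. g d (j + a))" by (subst sum.reindex) auto
    finally show "(\<Sum>\<^sub>\<infinity>k. (b d k * w j (k - d)) \<bullet> w j k) = (\<Sum>a\<in>A d. g d (j + a))" .
  qed
  have sn: "(\<lambda>j. (cmod (v (j + a)))\<^sup>2) summable_on UNIV" for a
    using l2_summable[OF v] summable_on_translate[of "\<lambda>k. (cmod (v k))\<^sup>2" a] by simp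
  have sg: "(\<lambda>j. g d (j + a)) summable_on UNIV" for d a
    using gs summable_on_translate by blast
  have sA: "(\<lambda>j. \<Sum>a\<in>A d. g d (j + a)) summable_on UNIV" for d
    by (intro summable_on_finite_sum sg) (simp add: A_def)
  \<comment> \<open>Every site lies in exactly \<open>W\<close> windows, so the squared norms of the
    cutoffs add up to \<open>W * nrm2 v\<close>.\<close>
  have "c * (of_int W * nrm2 v) = (\<Sum>\<^sub>\<infinity>j. c * nrm2 (w j))"
    unfolding nw using sn L
    by (simp add: infsum_cmult_right' infsum_finite_sum nrm2_translate[unfolded nrm2_def] nrm2_def)
  also have "\<dots> \<le> (\<Sum>\<^sub>\<infinity>j. qform L b (w j))"
  proof (rule infsum_mono)
    show "(\<lambda>j. c * nrm2 (w j)) summable_on UNIV"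
      unfolding nw by (intro summable_on_cmult_right summable_on_finite_sum sn) simp
    show "(\<lambda>j. qform L b (w j)) summable_on UNIV"
      unfolding qw by (intro summable_on_finite_sum sA) simp
  qed (unfold w_def, rule windows)
  also have "\<dots> = (\<Sum>d\<in>{-L..L}. \<Sum>\<^sub>\<infinity>j. \<Sum>a\<in>A d. g d (j + a))"
    unfolding qw by (intro infsum_finite_sum sA) simp
  also have "\<dots> = (\<Sum>d\<in>{-L..L}. (of_int W - of_int \<bar>d\<bar>) * G d)"
  proof (rule sum.cong[OF refl])
    fix d assume "d \<in> {-L..L}"
    have "(\<Sum>\<^sub>\<infinity>j. \<Sum>a\<in>A d. g d (j + a)) = (\<Sum>a\<in>A d. \<Sum>\<^sub>\<infinity>j. g d (j + a))"
      by (intro infsum_finite_sum sg) (simp add: A_def)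
    also have "\<dots> = of_nat (card (A d)) * G d" by (simp add: infsum_translate G_def)
    finally show "(\<Sum>\<^sub>\<infinity>j. \<Sum>a\<in>A d. g d (j + a)) = (of_int W - of_int \<bar>d\<bar>) * G d"
      using cardA[OF \<open>d \<in> {-L..L}\<close>] by simp
  qed
  \<comment> \<open>The deficit \<open>\<bar>d\<bar> * G d\<close> does not grow with
    \<open>W\<close>, so dividing by \<open>W\<close> at the end makes it small.\<close>
  also have "\<dots> \<le> (\<Sum>d\<in>{-L..L}. of_int W * G d + of_int \<bar>d\<bar> * (B * nrm2 v))"
  proof (rule sum_mono)
    fix d
    have "real_of_int \<bar>d\<bar> * - G d \<le> of_int \<bar>d\<bar> * (B * nrm2 v)"
      using G[of d] by (intro mult_left_mono) auto
    then show "(of_int W - of_int \<bar>d\<bar>) * G d \<le> of_int W * G d + of_int \<bar>d\<bar> * (B * nrm2 v)"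
      by (simp add: left_diff_distrib)
  qed
  also have "\<dots> = of_int W * qform L b v + of_int (\<Sum>d\<in>{-L..L}. \<bar>d\<bar>) * (B * nrm2 v)"
    by (simp add: sum.distrib sum_distrib_left sum_distrib_right qform_def G_def g_def)
  finally have *: "of_int W * (c * nrm2 v)
      \<le> of_int W * qform L b v + of_int (\<Sum>d\<in>{-L..L}. \<bar>d\<bar>) * (B * nrm2 v)"
    by (simp add: mult.left_commute)
  define Z where "Z = real_of_int (\<Sum>d\<in>{-L..L}. \<bar>d\<bar>)"
  from * have "of_int W * ((c - Z * B / of_int W) * nrm2 v) \<le> of_int W * qform L b v"
    unfolding Z_def[symmetric] using L by (simp add: left_diff_distrib right_diff_distrib mult.assoc)
  then show ?thesis using L unfolding Z_def[symmetric] by simp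
qed

section \<open>Forms of band operators, and spectra as depending on the action on
  \<open>l2 S\<close> alone\<close>

lemma (in selfadjoint_band) ip_T_qform:
  "v \<in> l2 S \<Longrightarrow> ip (T v) v = qform L b v"
  using ip_T[OF l2_subset_UNIV] by (simp add: qform_def)

text \<open>A resolvent \<open>R\<close> maps \<open>l2 S\<close> to itself, so \<open>T\<close> is
  evaluated only there. This is needed because \<open>Hop\<close> and its band matrix are identified
  only on \<open>l2 S\<close>.\<close>

lemma spectrum_on_cong:
  assumes "\<And>v. v \<in> l2 S \<Longrightarrow> T v = T' v"
  shows "spectrum_on S T = spectrum_on S T'"
proof -
  have "(bounded_op_on S R \<and> (\<forall>v\<in>l2 S. R (\<lambda>k. T v k - z * v k) = v)
       \<and> (\<forall>v\<in>l2 S. (\<lambda>k. T (R v) k - z * R v k) = v))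
    \<longleftrightarrow> (bounded_op_on S R \<and> (\<forall>v\<in>l2 S. R (\<lambda>k. T' v k - z * v k) = v)
       \<and> (\<forall>v\<in>l2 S. (\<lambda>k. T' (R v) k - z * R v k) = v))" for R z
  proof (rule conj_cong[OF refl])
    assume "bounded_op_on S R"
    then have "\<And>v. v \<in> l2 S \<Longrightarrow> R v \<in> l2 S" by (simp add: bounded_op_on_def)
    then show "((\<forall>v\<in>l2 S. R (\<lambda>k. T v k - z * v k) = v) \<and> (\<forall>v\<in>l2 S. (\<lambda>k. T (R v) k - z * R v k) = v))
      \<longleftrightarrow> ((\<forall>v\<in>l2 S. R (\<lambda>k. T' v k - z * v k) = v) \<and> (\<forall>v\<in>l2 S. (\<lambda>k. T' (R v) k - z * R v k) = v))"
      using assms by simp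
  qed
  then show ?thesis unfolding spectrum_on_def by presburger
qed

lemma inf_sp_cong: "(\<And>v. v \<in> l2 S \<Longrightarrow> T v = T' v) \<Longrightarrow> inf_sp S T = inf_sp S T'"
  unfolding inf_sp_def using spectrum_on_cong[of S T T'] by simp

section \<open>Spectra of the Hamiltonians\<close>

text \<open>If \<open>R\<close> inverts \<open>T - z\<close>, then \<open>R\<close> precomposed with
  negation inverts \<open>- T + z\<close>. The implication is kept general in \<open>T\<close> and
  \<open>z\<close>, so that applying it to \<open>- T\<close> and \<open>- z\<close> gives the
  converse.\<close>

lemma spectrum_on_uminus:
  "- z \<in> spectrum_on S (\<lambda>v k. - T v k) \<longleftrightarrow> z \<in> spectrum_on S T"
proof -
  have *: "\<exists>R'. bounded_op_on S R'
       \<and> (\<forall>v\<in>l2 S. R' (\<lambda>k. - T v k - - z * v k) = v)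
       \<and> (\<forall>v\<in>l2 S. (\<lambda>k. - T (R' v) k - - z * R' v k) = v)"
    if R: "bounded_op_on S R" "\<forall>v\<in>l2 S. R (\<lambda>k. T v k - z * v k) = v"
      "\<forall>v\<in>l2 S. (\<lambda>k. T (R v) k - z * R v k) = v" for R T and z :: complex
  proof (intro exI[of _ "\<lambda>v. R (\<lambda>k. - v k)"] conjI)
    have neg: "(\<lambda>k. - v k) \<in> l2 S" if "v \<in> l2 S" for v using that by (simp add: l2_def)
    have neg_norm: "l2norm S (\<lambda>k. - v k) = l2norm S v" for v by (simp add: l2norm_def)
    have lin_R: "R (\<lambda>k. a * u k + c * w k) = (\<lambda>k. a * R u k + c * R w k)"
      if "u \<in> l2 S" "w \<in> l2 S" for u w a c
      using R(1) that unfolding bounded_op_on_def by blast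
    have lin: "R (\<lambda>k. - (a * u k + c * w k)) = (\<lambda>k. a * R (\<lambda>k. - u k) k + c * R (\<lambda>k. - w k) k)"
      if "u \<in> l2 S" "w \<in> l2 S" for u w a c
    proof -
      have "R (\<lambda>k. a * (- u k) + c * (- w k)) = (\<lambda>k. a * R (\<lambda>k. - u k) k + c * R (\<lambda>k. - w k) k)"
        by (rule lin_R[OF neg[OF that(1)] neg[OF that(2)]])
      then show ?thesis by (simp add: add.commute)
    qed
    show "bounded_op_on S (\<lambda>v. R (\<lambda>k. - v k))"
      unfolding bounded_op_on_def
    proof (intro conjI ballI allI)
      obtain C where "\<forall>v\<in>l2 S. l2norm S (R v) \<le> C * l2norm S v"
        using R(1) unfolding bounded_op_on_def by blast
      then have "l2norm S (R (\<lambda>k. - v k)) \<le> C * l2norm S v" if "v \<in> l2 S" for v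
        using neg[OF that] neg_norm[of v] by metis
      then show "\<exists>C. \<forall>v\<in>l2 S. l2norm S (R (\<lambda>k. - v k)) \<le> C * l2norm S v" by blast
    next
      fix v assume "v \<in> l2 S"
      then show "R (\<lambda>k. - v k) \<in> l2 S"
        using R(1) neg unfolding bounded_op_on_def by blast
    qed (rule lin)
    show "\<forall>v\<in>l2 S. R (\<lambda>k. - (- T v k - - z * v k)) = v" using R(2) by simp
    show "\<forall>v\<in>l2 S. (\<lambda>k. - T (R (\<lambda>k. - v k)) k - - z * R (\<lambda>k. - v k) k) = v"
    proof
      fix v assume "v \<in> l2 S"
      with R(3) neg have "(\<lambda>k. T (R (\<lambda>k. - v k)) k - z * R (\<lambda>k. - v k) k) = (\<lambda>k. - v k)" by blast
      then show "(\<lambda>k. - T (R (\<lambda>k. - v k)) k - - z * R (\<lambda>k. - v k) k) = v"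
        by (simp add: fun_eq_iff algebra_simps)
    qed
  qed
  show ?thesis
    using *[where T = T and z = z] *[where T = "\<lambda>v k. - T v k" and z = "- z"]
    unfolding spectrum_on_def by (simp only: mem_Collect_eq minus_minus) blast
qed

lemma sup_sp_eq_uminus_inf_sp: "sup_sp S T = - inf_sp S (\<lambda>v k. - T v k)"
proof -
  have "{r. complex_of_real r \<in> spectrum_on S (\<lambda>v k. - T v k)} = uminus ` {r. complex_of_real r \<in> spectrum_on S T}"
  proof (intro set_eqI iffI)
    fix r assume "r \<in> {r. complex_of_real r \<in> spectrum_on S (\<lambda>v k. - T v k)}"
    then have "- r \<in> {r. complex_of_real r \<in> spectrum_on S T}"
      using spectrum_on_uminus[of "- complex_of_real r" S T] by simp
    then show "r \<in> uminus ` {r. complex_of_real r \<in> spectrum_on S T}" by (rule rev_image_eqI) simp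
  next
    fix r assume "r \<in> uminus ` {r. complex_of_real r \<in> spectrum_on S T}"
    then show "r \<in> {r. complex_of_real r \<in> spectrum_on S (\<lambda>v k. - T v k)}"
      using spectrum_on_uminus[of _ S T] by force
  qed
  then show ?thesis by (simp add: sup_sp_def inf_sp_def Inf_real_def image_image)
qed

lemma Hop_uminus: "Hop (\<lambda>x k. - h x k) N x = (\<lambda>v k. - Hop h N x v k)"
  by (simp add: Hop_def fun_eq_iff infsum_uminus)

section \<open>Finite-range Hamiltonians over a shift-invariant set\<close>

lemma shift_shift: "shift a (shift c x) = shift (a + c) x"
  by (simp add: shift_def fun_eq_iff algebra_simps)

lemma shift_0: "shift 0 x = x"
  by (simp add: shift_def)

text \<open>Topology is left out here: continuity and compact support of \<open>h\<close> enter
  through the range \<open>L\<close> and the bound \<open>B\<close>.\<close>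

locale finite_range_hamiltonian =
  fixes X :: "(int \<Rightarrow> 'a) set" and h :: "(int \<Rightarrow> 'a) \<Rightarrow> int \<Rightarrow> complex" and L :: int and B :: real
  assumes shift_closed: "\<And>k x. x \<in> X \<Longrightarrow> shift k x \<in> X"
    and L_nonneg: "0 \<le> L"
    and h_bound: "\<And>x m. x \<in> X \<Longrightarrow> cmod (h x m) \<le> B"
    and h_range: "\<And>x m. x \<in> X \<Longrightarrow> m \<notin> {-L..L} \<Longrightarrow> h x m = 0"
    and h_selfadjoint: "\<And>x k. x \<in> X \<Longrightarrow> h (shift k x) (- k) = cnj (h x k)"
begin

text \<open>The kernel of \<open>Hop\<close> in row \<open>k\<close> and column \<open>l\<close>,
  rewritten by diagonals with \<open>l = k - d\<close>.\<close>

definition entry :: "(int \<Rightarrow> 'a) \<Rightarrow> int \<Rightarrow> int \<Rightarrow> complex" where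
  "entry x d k = h (shift (k - d) x) d"

lemma entry_translate: "entry (shift m x) d k = entry x d (k + m)"
  by (simp add: entry_def shift_shift algebra_simps)

lemma entry_bound: "x \<in> X \<Longrightarrow> cmod (entry x d k) \<le> B"
  unfolding entry_def by (intro h_bound shift_closed)

lemma selfadjoint_band_entry:
  assumes "x \<in> X"
  shows "selfadjoint_band L (entry x) B"
proof
  show "cmod (entry x d k) \<le> B" for d k by (rule entry_bound[OF assms])
  show "cnj (entry x d (k + d)) = entry x (- d) k" for d k
    using h_selfadjoint[OF shift_closed[OF assms, of k], of d]
    by (simp add: entry_def shift_shift add.commute)
qed (rule L_nonneg)

lemma Hop_eq_band:
  assumes x: "x \<in> X" and v: "v \<in> l2 (Zset N x)"
  shows "Hop h N x v = band (Zset N x) L (entry x) v"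
proof
  fix k
  have "(\<Sum>\<^sub>\<infinity>l\<in>Zset N x. h (shift l x) (k - l) * v l) = (\<Sum>\<^sub>\<infinity>l\<in>{k-L..k+L}. h (shift l x) (k - l) * v l)"
    using l2_zero_outside[OF v] h_range[OF shift_closed[OF x]]
    by (intro infsum_cong_neutral) auto
  also have "\<dots> = (\<Sum>l\<in>{k-L..k+L}. h (shift l x) (k - l) * v l)" by (rule infsum_finite) simp
  also have "\<dots> = (\<Sum>d\<in>{-L..L}. entry x d k * v (k - d))"
    by (rule sum.reindex_bij_witness[of _ "\<lambda>d. k - d" "\<lambda>l. k - l"]) (auto simp: entry_def)
  finally show "Hop h N x v k = band (Zset N x) L (entry x) v k"
    by (simp add: Hop_def band_def)
qed

lemma le_inf_sp_Hop_iff: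
  assumes "x \<in> N" "N \<subseteq> X"
  shows "c \<le> inf_sp (Zset N x) (Hop h N x)
    \<longleftrightarrow> (\<forall>v\<in>l2 (Zset N x). c * nrm2 v \<le> qform L (entry x) v)"
proof -
  have x: "x \<in> X" using assms by blast
  interpret selfadjoint_band "Zset N x" L "entry x" B by (rule selfadjoint_band_entry[OF x])
  have "0 \<in> Zset N x" using assms(1) by (simp add: Zset_def shift_0)
  then show ?thesis
    using le_inf_sp_iff inf_sp_cong[OF Hop_eq_band[OF x]] by (auto simp: ip_T_qform)
qed

text \<open>Localise to windows of length \<open>W\<close>. A nonzero cutoff contains a site
  \<open>k0\<close> with \<open>shift k0 y\<close> in \<open>N\<close>; seen from there, the whole
  window resembles one seen from a point of \<open>Y\<close>. The two losses come from
  \<open>qform_perturb\<close> and \<open>qform_localize\<close>.\<close>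

lemma inf_sp_stable:
  assumes Y: "Y \<subseteq> X" "\<And>k x. x \<in> Y \<Longrightarrow> shift k x \<in> Y"
    and c: "\<And>x. x \<in> Y \<Longrightarrow> c \<le> inf_sp (Zset Y x) (Hop h Y x)"
    and N: "N \<subseteq> X" and W: "L < W" and "0 \<le> \<eta>"
    and near: "\<And>z. z \<in> N \<Longrightarrow> \<exists>x\<in>Y. \<forall>a\<in>{-W..W}. \<forall>m\<in>{-L..L}.
        cmod (h (shift a z) m - h (shift a x) m) \<le> \<eta>"
    and y: "y \<in> N"
  shows "c - (2 * of_int L + 1) * \<eta> - of_int (\<Sum>d\<in>{-L..L}. \<bar>d\<bar>) * B / of_int W
      \<le> inf_sp (Zset N y) (Hop h N y)"
  unfolding le_inf_sp_Hop_iff[OF y N]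
proof
  fix v assume v: "v \<in> l2 (Zset N y)"
  have yX: "y \<in> X" using y N by blast
  have B: "0 \<le> B" using h_bound[OF yX, of 0] norm_ge_zero order_trans by blast
  show "(c - (2 * of_int L + 1) * \<eta> - of_int (\<Sum>d\<in>{-L..L}. \<bar>d\<bar>) * B / of_int W) * nrm2 v
      \<le> qform L (entry y) v"
  proof (rule qform_localize[OF l2_subset_UNIV[OF v] L_nonneg W entry_bound[OF yX] B])
    fix j
    define w where "w = (\<lambda>k. if k \<in> {j..<j+W} then v k else 0)"
    have w: "w \<in> l2 UNIV" by (rule l2_finite_support[of "{j..<j+W}"]) (auto simp: w_def)
    have "(c - (2 * of_int L + 1) * \<eta>) * nrm2 w \<le> qform L (entry y) w"
    proof (cases "\<exists>k. w k \<noteq> 0")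
      case False
      then have "w = (\<lambda>_. 0)" by auto
      then show ?thesis by (simp add: nrm2_def qform_def)
    next
      case True
      then obtain k0 where k0: "k0 \<in> {j..<j+W}" "v k0 \<noteq> 0" by (auto simp: w_def split: if_splits)
      then have "shift k0 y \<in> N" using l2_zero_outside[OF v, of k0] by (auto simp: Zset_def)
      from near[OF this] obtain x where x: "x \<in> Y" and
        close: "\<And>a m. a \<in> {-W..W} \<Longrightarrow> m \<in> {-L..L} \<Longrightarrow>
          cmod (h (shift a (shift k0 y)) m - h (shift a x) m) \<le> \<eta>" by blast
      define u where "u = (\<lambda>k. w (k + k0))"
      have u: "u \<in> l2 UNIV" unfolding u_def using w by (simp add: l2_translate)
      have nu: "nrm2 u = nrm2 w" unfolding u_def by (rule nrm2_translate)
      \<comment> \<open>Invariance of \<open>Y\<close> makes every square-summable vector admissible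
        for \<open>x\<close>, whereas \<open>Zset N y\<close> may have gaps.\<close>
      have "Zset Y x = UNIV" using Y(2)[OF x] by (auto simp: Zset_def)
      then have "c * nrm2 u \<le> qform L (entry x) u"
        using le_inf_sp_Hop_iff[OF x Y(1), of c] c[OF x] u by simp
      moreover have "qform L (entry x) u - (2 * of_int L + 1) * \<eta> * nrm2 u
          \<le> qform L (entry (shift k0 y)) u"
      proof (rule qform_perturb[OF u L_nonneg \<open>0 \<le> \<eta>\<close> B])
        show "cmod (entry (shift k0 y) d k) \<le> B" for d k
          by (intro entry_bound shift_closed yX)
        show "cmod (entry x d k) \<le> B" for d k
          using x Y(1) by (intro entry_bound) auto
        \<comment> \<open>Both the column \<open>k - d + k0\<close> and the centre \<open>k0\<close>
          lie in one window of length \<open>W\<close>, so their difference is a shift covered by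
          \<open>close\<close>.\<close>
        fix d k assume "d \<in> {-L..L}" "u (k - d) \<noteq> 0"
        moreover from this(2) have "k - d + k0 \<in> {j..<j+W}" by (auto simp: u_def w_def split: if_splits)
        with k0(1) have "k - d \<in> {-W..W}" by auto
        ultimately show "cmod (entry (shift k0 y) d k - entry x d k) \<le> \<eta>"
          unfolding entry_def by (intro close)
      qed
      moreover have "qform L (entry (shift k0 y)) u = qform L (entry y) w"
        unfolding u_def entry_translate by (rule qform_translate)
      ultimately show ?thesis by (simp add: nu algebra_simps)
    qed
    then show "(c - (2 * of_int L + 1) * \<eta>) * nrm2 (\<lambda>k. if k \<in> {j..<j+W} then v k else 0)
        \<le> qform L (entry y) (\<lambda>k. if k \<in> {j..<j+W} then v k else 0)"
      unfolding w_def .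
  qed
qed

end

section \<open>Fell convergence\<close>

lemma continuous_map_shift: "continuous_map fullshift_top fullshift_top (shift a)"
  unfolding fullshift_top_def continuous_map_componentwise_UNIV shift_def
  by (intro allI continuous_map_product_projection) simp

lemma topspace_fullshift [simp]: "topspace fullshift_top = UNIV"
  by (simp add: fullshift_top_def)

lemma compact_fullshift: "compact_space (fullshift_top :: (int \<Rightarrow> 'a::finite) topology)"
  unfolding fullshift_top_def
  by (simp add: compact_space_product_topology compact_space_discrete_topology)

lemma continuous_map_section:
  assumes "continuous_map (prod_topology T (discrete_topology UNIV)) euclidean (\<lambda>(x, k). h x k)"
  shows "continuous_map T euclidean (\<lambda>x. h x (m::int))"
proof -
  have "continuous_map T (prod_topology T (discrete_topology UNIV)) (\<lambda>x. (x, m))"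
    by (intro continuous_map_pairedI) auto
  from continuous_map_compose[OF this assms] show ?thesis by (simp add: o_def)
qed

text \<open>The projection of the support to the discrete integers is compact, hence finite; the sum
  of the absolute values of its elements is a convenient upper bound for each of them.\<close>

lemma compactly_supported_range:
  fixes h :: "'b \<Rightarrow> int \<Rightarrow> complex"
  assumes "compactin (prod_topology T (discrete_topology UNIV))
      ((prod_topology T (discrete_topology UNIV)) closure_of {(x, k). x \<in> topspace T \<and> h x k \<noteq> 0})"
  shows "\<exists>L\<ge>0. \<forall>x\<in>topspace T. \<forall>m. m \<notin> {-L..L} \<longrightarrow> h x m = 0"
proof -
  let ?P = "prod_topology T (discrete_topology (UNIV :: int set))"
  let ?A = "{(x, k). x \<in> topspace T \<and> h x k \<noteq> 0}"
  have "compactin (discrete_topology UNIV) (snd ` (?P closure_of ?A))"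
    by (rule image_compactin[OF assms continuous_map_snd])
  then have fin: "finite (snd ` (?P closure_of ?A))" by (simp add: compactin_discrete_topology)
  have sub: "?A \<subseteq> ?P closure_of ?A"
    by (intro closure_of_subset) auto
  define L where "L = (\<Sum>k\<in>snd ` (?P closure_of ?A). \<bar>k\<bar>)"
  have "\<bar>m\<bar> \<le> L" if "x \<in> topspace T" "h x m \<noteq> 0" for x m
  proof -
    have "(x, m) \<in> ?A" using that by simp
    with sub have "(x, m) \<in> ?P closure_of ?A" by (rule subsetD)
    then have "m \<in> snd ` (?P closure_of ?A)" by (rule rev_image_eqI) simp
    then show ?thesis unfolding L_def using fin by (intro member_le_sum) auto
  qed
  then have "\<forall>x\<in>topspace T. \<forall>m. m \<notin> {-L..L} \<longrightarrow> h x m = 0" by (fastforce simp: abs_le_iff)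
  moreover have "0 \<le> L" unfolding L_def by (intro sum_nonneg) auto
  ultimately show ?thesis by blast
qed

lemma finite_range_bounded:
  fixes h :: "'b \<Rightarrow> int \<Rightarrow> complex"
  assumes "compact_space T" "\<And>m. continuous_map T euclidean (\<lambda>x. h x m)"
    and "\<forall>x\<in>topspace T. \<forall>m. m \<notin> {-L..L} \<longrightarrow> h x m = 0"
  shows "\<exists>B. \<forall>x\<in>topspace T. \<forall>m. cmod (h x m) \<le> B"
proof -
  have "compact ((\<lambda>x. h x m) ` topspace T)" for m
    using image_compactin[OF _ assms(2)] assms(1) by (fastforce simp: compact_space_def)
  then have "bounded (\<Union>m\<in>{-L..L}. (\<lambda>x. h x m) ` topspace T)"
    by (intro bounded_UN) (auto intro: compact_imp_bounded)
  then obtain B where B: "\<forall>z\<in>(\<Union>m\<in>{-L..L}. (\<lambda>x. h x m) ` topspace T). cmod z \<le> B"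
    unfolding bounded_iff by blast
  have "cmod (h x m) \<le> max B 0" if "x \<in> topspace T" for x m
  proof (cases "m \<in> {-L..L}")
    case True
    with B that have "cmod (h x m) \<le> B" by blast
    then show ?thesis by simp
  next
    case False
    with assms(3) that show ?thesis by simp
  qed
  then show ?thesis by blast
qed

text \<open>A union over \<open>Y\<close> of finite intersections of preimages of open balls, which
  is why the inequality is strict. Intersecting with \<open>topspace T\<close> also covers empty
  \<open>J\<close>.\<close>

lemma openin_uniformly_near:
  fixes f :: "'j \<Rightarrow> 'b \<Rightarrow> complex"
  assumes "finite J" "\<And>j. j \<in> J \<Longrightarrow> continuous_map T euclidean (f j)"
  shows "openin T {z \<in> topspace T. \<exists>x\<in>Y. \<forall>j\<in>J. cmod (f j z - f j x) < \<eta>}"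
proof -
  have "openin T {z \<in> topspace T. cmod (f j z - f j x) < \<eta>}" if "j \<in> J" for j x
    using openin_continuous_map_preimage[OF assms(2)[OF that], of "ball (f j x) \<eta>"]
    by (simp add: dist_norm norm_minus_commute)
  then have "openin T ((\<Inter>j\<in>J. {z \<in> topspace T. cmod (f j z - f j x) < \<eta>}) \<inter> topspace T)" for x
    by (intro openin_INT assms(1))
  then have "openin T (\<Union>x\<in>Y. (\<Inter>j\<in>J. {z \<in> topspace T. cmod (f j z - f j x) < \<eta>}) \<inter> topspace T)"
    by blast
  moreover have "(\<Union>x\<in>Y. (\<Inter>j\<in>J. {z \<in> topspace T. cmod (f j z - f j x) < \<eta>}) \<inter> topspace T)
      = {z \<in> topspace T. \<exists>x\<in>Y. \<forall>j\<in>J. cmod (f j z - f j x) < \<eta>}" by auto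
  ultimately show ?thesis by simp
qed

text \<open>In a compact space the complement of \<open>U\<close> is compact, and \<open>Y\<close>
  misses it; so it can serve as the set \<open>K\<close> of a basic neighbourhood, with the empty
  family of open sets.\<close>

lemma fell_converges_eventually_subset:
  assumes "fell_converges T I le M Y" "compact_space T" "openin T U" "Y \<subseteq> U"
    and "directed_set I le" "\<forall>i\<in>I. M i \<subseteq> topspace T"
  shows "\<exists>i\<in>I. M i \<subseteq> U"
proof -
  have "compactin T (topspace T - U)"
    using assms(2,3) by (intro closedin_compact_space) auto
  moreover have "Y \<inter> (topspace T - U) = {}" using assms(4) by blast
  ultimately have "net_eventually I le (\<lambda>i. M i \<inter> (topspace T - U) = {} \<and> (\<forall>U\<in>{}. M i \<inter> U \<noteq> {}))"
    using assms(1) unfolding fell_converges_def by blast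
  then obtain i where i: "i \<in> I" "\<forall>j\<in>I. le i j \<longrightarrow> M j \<inter> (topspace T - U) = {}"
    unfolding net_eventually_def by auto
  moreover have "le i i" using assms(5) i(1) by (simp add: directed_set_def)
  ultimately have "M i \<inter> (topspace T - U) = {}" by simp
  moreover have "M i \<subseteq> topspace T" using assms(6) i(1) by simp
  ultimately show ?thesis using i(1) by blast
qed

text \<open>Stated for infima only, so that it can be applied both to \<open>h\<close> and to
  \<open>- h\<close>. Extended reals give the infimum over an empty set its natural value.\<close>

lemma inf_sp_fell_limit:
  fixes X Xinf :: "(int \<Rightarrow> 'a::finite) set"
    and I :: "'i set" and le :: "'i \<Rightarrow> 'i \<Rightarrow> bool"
    and M :: "'i \<Rightarrow> (int \<Rightarrow> 'a) set"
    and h :: "(int \<Rightarrow> 'a) \<Rightarrow> int \<Rightarrow> complex"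
  assumes X: "subshift X" and Xinf: "Xinf \<subseteq> X"
    and inv: "\<forall>k. \<forall>x\<in>Xinf. shift k x \<in> Xinf"
    and dir: "directed_set I le"
    and MX: "\<forall>i\<in>I. M i \<subseteq> X" and XM: "\<forall>i\<in>I. Xinf \<subseteq> M i"
    and fell: "fell_converges (subtopology fullshift_top X) I le M Xinf"
    and cont: "continuous_map (prod_topology (subtopology fullshift_top X) (discrete_topology UNIV))
           euclidean (\<lambda>(x, k). h x k)"
    and supp: "compactin (prod_topology (subtopology fullshift_top X) (discrete_topology UNIV))
           ((prod_topology (subtopology fullshift_top X) (discrete_topology UNIV)) closure_of
              {(x, k). x \<in> X \<and> h x k \<noteq> 0})"
    and sa: "\<forall>x\<in>X. \<forall>k. h (shift k x) (- k) = cnj (h x k)"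
  shows "(INF x\<in>Xinf. ereal (inf_sp (Zset Xinf x) (Hop h Xinf x)))
           = (SUP i\<in>I. INF y\<in>M i. ereal (inf_sp (Zset (M i) y) (Hop h (M i) y)))"
    (is "?lhs = ?rhs")
proof (rule antisym)
  have same: "inf_sp (Zset (M i) x) (Hop h (M i) x) = inf_sp (Zset Xinf x) (Hop h Xinf x)"
    if "i \<in> I" "x \<in> Xinf" for i x
  proof -
    have "Zset Xinf x = UNIV" "Zset (M i) x = UNIV"
      using inv XM that by (auto simp: Zset_def)
    then show ?thesis by (simp add: Hop_def[abs_def])
  qed
  show "?rhs \<le> ?lhs"
  proof (intro SUP_least INF_greatest)
    fix i x assume ix: "i \<in> I" "x \<in> Xinf"
    then have "x \<in> M i" using XM by blast
    then show "(INF y\<in>M i. ereal (inf_sp (Zset (M i) y) (Hop h (M i) y)))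
        \<le> ereal (inf_sp (Zset Xinf x) (Hop h Xinf x))"
      unfolding same[OF ix, symmetric] by (rule INF_lower)
  qed
next
  define T where "T = subtopology fullshift_top X"
  have TX: "topspace T = X" by (simp add: T_def)
  have shiftX: "shift k x \<in> X" if "x \<in> X" for k x using X that by (auto simp: subshift_def)
  have "compactin fullshift_top X"
    using X compact_fullshift by (intro closedin_compact_space) (auto simp: subshift_def)
  then have compT: "compact_space T"
    unfolding T_def by (simp add: compact_space_subtopology)
  have h_cont: "continuous_map T euclidean (\<lambda>x. h x m)" for m
    using cont unfolding T_def by (rule continuous_map_section)
  have shift_cont: "continuous_map T T (shift a)" for a
    unfolding T_def using shiftX
    by (intro continuous_map_into_subtopology continuous_map_from_subtopology continuous_map_shift) auto
  obtain L where L: "0 \<le> L" "\<forall>x\<in>X. \<forall>m. m \<notin> {-L..L} \<longrightarrow> h x m = 0"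
    using compactly_supported_range[of T h] supp unfolding TX by (auto simp: T_def)
  obtain B where B: "\<forall>x\<in>X. \<forall>m. cmod (h x m) \<le> B"
    using finite_range_bounded[of T h L, OF compT h_cont] L(2) unfolding TX by blast
  interpret finite_range_hamiltonian X h L B
    by (rule finite_range_hamiltonian.intro)
      (fact shiftX L(1) B[rule_format] L(2)[rule_format] sa[rule_format])+
  \<comment> \<open>Testing against real upper bounds \<open>z\<close> of the right-hand side keeps
    the epsilon argument within the reals, even if the left-hand side is infinite.\<close>
  show "?lhs \<le> ?rhs"
  proof (rule ereal_le_real)
    fix z assume z: "?rhs \<le> ereal z"
    show "?lhs \<le> ereal z"
    proof (rule ccontr)
      assume "\<not> ?thesis"
      then have "ereal z < ?lhs" by (simp only: not_le)
      then obtain c where c: "ereal z < ereal c" "ereal c < ?lhs"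
        using ereal_dense2[of "ereal z" ?lhs] by auto
      define \<epsilon> where "\<epsilon> = (c - z) / 2"
      have \<epsilon>: "0 < \<epsilon>" "z < c - \<epsilon>" using c(1) by (auto simp: \<epsilon>_def field_simps)
      have le_c: "c \<le> inf_sp (Zset Xinf x) (Hop h Xinf x)" if "x \<in> Xinf" for x
      proof -
        have "ereal c \<le> ereal (inf_sp (Zset Xinf x) (Hop h Xinf x))"
          by (rule order_trans[OF less_imp_le[OF c(2)] INF_lower[OF that]])
        then show ?thesis by simp
      qed
      \<comment> \<open>Half of \<open>\<epsilon>\<close> is spent on the perturbation of the
        \<open>2 * L + 1\<close> diagonals, the other half on localisation.\<close>
      define \<eta> where "\<eta> = \<epsilon> / 2 / (2 * of_int L + 1)"
      have Lpos: "0 < 2 * real_of_int L + 1" using L(1) by simp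
      have \<eta>: "0 < \<eta>" using \<epsilon>(1) Lpos by (simp add: \<eta>_def)
      have L\<eta>: "(2 * of_int L + 1) * \<eta> = \<epsilon> / 2"
        using Lpos unfolding \<eta>_def by (subst times_divide_eq_right, subst nonzero_mult_div_cancel_left) auto
      define Z where "Z = of_int (\<Sum>d\<in>{-L..L}. \<bar>d\<bar>) * B"
      \<comment> \<open>The first entry makes the windows longer than the range, the second makes
        the localisation error \<open>Z / W\<close> at most \<open>\<epsilon> / 2\<close>.\<close>
      define W where "W = max (L + 1) \<lceil>Z / (\<epsilon> / 2)\<rceil>"
      have W: "L < W" "0 < W" using L(1) by (auto simp: W_def)
      have "Z / (\<epsilon> / 2) \<le> of_int \<lceil>Z / (\<epsilon> / 2)\<rceil>" by (rule le_of_int_ceiling)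
      also have "\<dots> \<le> of_int W" unfolding of_int_le_iff W_def by (rule max.cobounded2)
      finally have ZW: "Z / of_int W \<le> \<epsilon> / 2" using \<epsilon>(1) W(2) by (simp add: field_simps)
      define J where "J = {-W..W} \<times> {-L..L}"
      define f where "f = (\<lambda>(a, m) z. h (shift a z) m)"
      \<comment> \<open>The points whose Hamiltonian looks, over shifts up to \<open>W\<close>, like
        that of some point of \<open>Xinf\<close>: an open neighbourhood of \<open>Xinf\<close> that
        must contain some \<open>M i\<close>.\<close>
      define U where "U = {z \<in> topspace T. \<exists>x\<in>Xinf. \<forall>j\<in>J. cmod (f j z - f j x) < \<eta>}"
      have "openin T U"
        unfolding U_def
      proof (rule openin_uniformly_near)
        show "finite J" by (simp add: J_def)
        show "continuous_map T euclidean (f j)" for j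
          using continuous_map_compose[OF shift_cont h_cont]
          by (cases j) (simp add: f_def o_def)
      qed
      moreover have "Xinf \<subseteq> U"
      proof
        fix x assume "x \<in> Xinf"
        then show "x \<in> U" using Xinf \<eta> by (auto simp: U_def TX intro!: bexI[of _ x])
      qed
      ultimately obtain i where i: "i \<in> I" "M i \<subseteq> U"
        using fell_converges_eventually_subset[of T I le M Xinf U] fell compT dir MX
        by (auto simp: T_def)
      have "c - \<epsilon> \<le> inf_sp (Zset (M i) y) (Hop h (M i) y)" if y: "y \<in> M i" for y
      proof -
        have "c - (2 * of_int L + 1) * \<eta> - Z / of_int W \<le> inf_sp (Zset (M i) y) (Hop h (M i) y)"
          unfolding Z_def
        proof (rule inf_sp_stable[OF Xinf _ le_c _ W(1)])
          fix z assume "z \<in> M i"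
          then obtain x where "x \<in> Xinf" "\<forall>j\<in>J. cmod (f j z - f j x) < \<eta>"
            using i(2) by (auto simp: U_def)
          then show "\<exists>x\<in>Xinf. \<forall>a\<in>{-W..W}. \<forall>m\<in>{-L..L}. cmod (h (shift a z) m - h (shift a x) m) \<le> \<eta>"
            by (intro bexI[of _ x]) (auto simp: J_def f_def intro: less_imp_le)
        qed (use inv MX i(1) \<eta> y in auto)
        then show ?thesis using L\<eta> ZW by linarith
      qed
      then have "ereal (c - \<epsilon>) \<le> (INF y\<in>M i. ereal (inf_sp (Zset (M i) y) (Hop h (M i) y)))"
        by (intro INF_greatest) simp
      also have "\<dots> \<le> ?rhs" using i(1) by (rule SUP_upper)
      also note z
      finally show False using \<epsilon>(2) by simp
    qed
  qed
qed

theorem theorem8p3: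
  fixes X Xinf :: "(int \<Rightarrow> 'a::finite) set"
    and I :: "'i set" and le :: "'i \<Rightarrow> 'i \<Rightarrow> bool"
    and M :: "'i \<Rightarrow> (int \<Rightarrow> 'a) set"
    and h :: "(int \<Rightarrow> 'a) \<Rightarrow> int \<Rightarrow> complex"
  assumes "subshift X"
    and "Xinf \<subseteq> X" and "closedin fullshift_top Xinf"
    and "\<forall>k. \<forall>x\<in>Xinf. shift k x \<in> Xinf"
    and "directed_set I le"
    and "\<forall>i\<in>I. M i \<subseteq> X \<and> closedin (subtopology fullshift_top X) (M i)
                        \<and> openin (subtopology fullshift_top X) (M i)"
    and "\<forall>i\<in>I. Xinf \<subseteq> M i"
    and "fell_converges (subtopology fullshift_top X) I le M Xinf"
    and "continuous_map (prod_topology (subtopology fullshift_top X) (discrete_topology UNIV))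
           euclidean (\<lambda>(x, k). h x k)"
    and "compactin (prod_topology (subtopology fullshift_top X) (discrete_topology UNIV))
           ((prod_topology (subtopology fullshift_top X) (discrete_topology UNIV)) closure_of
              {(x, k). x \<in> X \<and> h x k \<noteq> 0})"
    and "\<forall>x\<in>X. \<forall>k. h (shift k x) (- k) = cnj (h x k)"
  shows "((INF x\<in>Xinf. ereal (inf_sp (Zset Xinf x) (Hop h Xinf x)))
           = (SUP i\<in>I. INF y\<in>M i. ereal (inf_sp (Zset (M i) y) (Hop h (M i) y))))
    \<and> ((SUP x\<in>Xinf. ereal (sup_sp (Zset Xinf x) (Hop h Xinf x)))
           = (INF i\<in>I. SUP y\<in>M i. ereal (sup_sp (Zset (M i) y) (Hop h (M i) y))))"
proof
  have MX: "\<forall>i\<in>I. M i \<subseteq> X" using assms(6) by blast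
  show "(INF x\<in>Xinf. ereal (inf_sp (Zset Xinf x) (Hop h Xinf x)))
      = (SUP i\<in>I. INF y\<in>M i. ereal (inf_sp (Zset (M i) y) (Hop h (M i) y)))"
    by (rule inf_sp_fell_limit[OF assms(1,2,4,5) MX assms(7-11)])
  \<comment> \<open>Negation preserves continuity, support and self-adjointness, and it exchanges
    suprema and infima of extended reals.\<close>
  define h' where "h' = (\<lambda>x k. - h x k)"
  have sup: "ereal (sup_sp S (Hop h N x)) = - ereal (inf_sp S (Hop h' N x))" for S N x
    by (simp add: sup_sp_eq_uminus_inf_sp Hop_uminus h'_def)
  have "(\<lambda>(x, k). h' x k) = (\<lambda>p. - (case p of (x, k) \<Rightarrow> h x k))" by (auto simp: h'_def)
  then have cont': "continuous_map (prod_topology (subtopology fullshift_top X) (discrete_topology UNIV))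
      euclidean (\<lambda>(x, k). h' x k)"
    using continuous_map_minus[OF assms(9)] by simp
  have "(INF x\<in>Xinf. ereal (inf_sp (Zset Xinf x) (Hop h' Xinf x)))
      = (SUP i\<in>I. INF y\<in>M i. ereal (inf_sp (Zset (M i) y) (Hop h' (M i) y)))"
    by (rule inf_sp_fell_limit[OF assms(1,2,4,5) MX assms(7,8) cont'])
      (use assms(10,11) in \<open>simp_all add: h'_def\<close>)
  then show "(SUP x\<in>Xinf. ereal (sup_sp (Zset Xinf x) (Hop h Xinf x)))
      = (INF i\<in>I. SUP y\<in>M i. ereal (sup_sp (Zset (M i) y) (Hop h (M i) y)))"
    unfolding sup ereal_SUP_uminus_eq ereal_INF_uminus_eq by simp
qed

end
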